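(* Let $\phi$ be a positive function on $[1,\infty)$ such that $\lim_{x\to\infty}\phi(x)=0$. Then there exists a function $f$, analytic in $\mathbb{D}$, such that for every $p$ with $1\le p<\infty$ one has $f\in H^p$ and $$\sum_{n=2}^\infty \frac{E_{n}(f,H^{p})}{n \sqrt{\log n}}\, \phi(n) <\infty,$$ but $f'\notin A^1(\mathbb{D})$.
   Context: $\mathbb{D}$ is the open unit disc in $\mathbb{C}$; $H^p$ is the standard Hardy space in $\mathbb{D}$ with norm $\|\cdot\|_{H^p}$; $A^1(\mathbb{D})$ is the usual (unweighted) Bergman space of functions analytic in $\mathbb{D}$ and integrable with respect to area measure. $E_n(f,H^p)=\inf\{\|f-g\|_{H^p}\}$, where the infimum is over all polynomials $g$ of degree at most $n$ (best polynomial approximation in $H^p$). *)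

theory Defs
  imports "HOL-Complex_Analysis.Complex_Analysis"
    "HOL-Computational_Algebra.Polynomial"
begin

definition integral_mean :: "real \<Rightarrow> real \<Rightarrow> (complex \<Rightarrow> complex) \<Rightarrow> real" where
  "integral_mean p r f =
     (1 / (2 * pi) * integral {0..2 * pi} (\<lambda>t. norm (f (of_real r * cis t)) powr p)) powr (1 / p)"

definition hardy_space :: "real \<Rightarrow> (complex \<Rightarrow> complex) set" where
  "hardy_space p = {f. f holomorphic_on ball 0 1 \<and>
     bdd_above ((\<lambda>r. integral_mean p r f) ` {0..<1})}"

text \<open>The supremum is real-valued, so it is meaningful only for members of the Hardy space.\<close>

definition hardy_norm :: "real \<Rightarrow> (complex \<Rightarrow> complex) \<Rightarrow> real" where
  "hardy_norm p f = (SUP r\<in>{0..<1}. integral_mean p r f)"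

definition best_poly_approx :: "nat \<Rightarrow> (complex \<Rightarrow> complex) \<Rightarrow> real \<Rightarrow> real" where
  "best_poly_approx n f p =
     (INF g\<in>{g :: complex poly. degree g \<le> n}. hardy_norm p (\<lambda>z. f z - poly g z))"

definition bergman_space1 :: "(complex \<Rightarrow> complex) set" where
  "bergman_space1 = {f. f holomorphic_on ball 0 1 \<and> set_integrable lborel (ball 0 1) f}"

end

theory Submission
  imports Defs
begin

text \<open>The function is a lacunary series \<open>f z = (\<Sum>k. a k * z ^ (2 ^ k))\<close> with nonnegative coefficients.
  A weighted average over roots of unity isolates a single term of \<open>deriv f\<close>; integrating it over
  the annulus \<open>1 - 1 / 2 ^ k \<le> norm z < 1 - 1 / 2 ^ Suc k\<close> shows that the integral of \<open>norm (deriv f)\<close>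
  there is at least a constant times \<open>a k\<close>, so \<open>deriv f\<close> can be integrable only if \<open>a\<close> is summable.
  On the other hand, the Hardy norms of \<open>f\<close> minus a partial sum are bounded for every \<open>p\<close> by a
  constant times the \<open>\<ell>\<^sup>2\<close> norm of the remaining coefficients.
  With \<open>a k = 1 / k\<close> on one block \<open>{2 ^ e..<2 ^ Suc e}\<close>, the sum of the coefficients is at least
  \<open>1 / 2\<close>, whereas the weighted sum of the approximation errors is of order
  \<open>(\<Sum>n<2 ^ 2 ^ Suc e. \<phi> n / (n * sqrt (ln n))) / sqrt (2 ^ e)\<close>, which tends to \<open>0\<close> with \<open>e\<close> because
  \<open>\<phi>\<close> tends to \<open>0\<close>. It remains to take infinitely many sufficiently sparse blocks.\<close>

unbundle no fps_syntax

subsection \<open>Rotation invariance of Lebesgue measure on the plane\<close>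

text \<open>Boxes pull back to boxes with the same side lengths, and boxes determine the measure.
  This identification lets facts about orthogonal maps of \<open>real^2\<close> be used in the
  complex plane.\<close>

lemma lborel_distr_complex_of_vec:
  "distr lborel borel (\<lambda>v::real^2. Complex (v $ 1) (v $ 2)) = lborel"
proof (rule lborel_eqI[symmetric])
  let ?g = "\<lambda>v::real^2. Complex (v $ 1) (v $ 2)"
  have meas: "?g \<in> borel_measurable borel"
    unfolding complex_eq by (intro borel_measurable_continuous_onI continuous_intros)
  fix l u :: complex
  assume lu: "\<And>b. b \<in> Basis \<Longrightarrow> l \<bullet> b \<le> u \<bullet> b"
  have "Re l \<le> Re u" "Im l \<le> Im u"
    using lu[of 1] lu[of \<i>] by (auto simp: Basis_complex_def)
  let ?l = "vector [Re l, Im l] :: real^2" and ?u = "vector [Re u, Im u] :: real^2"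
  have "?g -` box l u = box ?l ?u"
    by (auto simp: in_box_complex_iff mem_box_cart forall_2)
  then have "emeasure (distr lborel borel ?g) (box l u) = emeasure lborel (box ?l ?u)"
    using meas by (subst emeasure_distr) auto
  also have "\<dots> = ennreal ((Re u - Re l) * (Im u - Im l))"
    using \<open>Re l \<le> Re u\<close> \<open>Im l \<le> Im u\<close>
    by (subst emeasure_lborel_box)
      (auto simp: Basis_vec_def cart_eq_inner_axis[symmetric] inner_axis forall_2 UNIV_2
        axis_eq_axis prod.insert)
  finally show "emeasure (distr lborel borel ?g) (box l u) = (\<Prod>b\<in>Basis. (u - l) \<bullet> b)"
    by (simp add: Basis_complex_def)
qed simp

text \<open>In real coordinates, multiplication by a unimodular number is an orthogonal map, and
  such maps preserve Lebesgue measure. Comparing the two measures on boxes is enough.\<close>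

lemma lborel_distr_complex_mult:
  fixes c :: complex
  assumes c: "norm c = 1"
  shows "distr lborel borel ((*) c) = lborel"
proof (rule lborel_eqI[symmetric])
  let ?g = "\<lambda>v::real^2. Complex (v $ 1) (v $ 2)"
  let ?h = "\<lambda>z::complex. vector [Re z, Im z] :: real^2"
  have gmeas: "?g \<in> borel_measurable borel"
    unfolding complex_eq by (intro borel_measurable_continuous_onI continuous_intros)
  have gh: "?g (?h z) = z" for z by (simp add: complex_eq_iff)
  have hg: "?h (?g v) = v" for v by (simp add: vec_eq_iff forall_2)
  \<comment> \<open>\<open>T\<close> is multiplication by \<open>cnj c\<close>, the inverse of
    \<open>c\<close>, in coordinates: a preimage under multiplication by \<open>c\<close> thus
    becomes an image under \<open>T\<close>, the form in which orthogonal invariance is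
    stated.\<close>
  define T where "T = (\<lambda>v. ?h (cnj c * ?g v))"
  have cc: "c * cnj c = 1" using c complex_norm_square[of c] by simp
  have cnj_cancel: "cnj c * (c * w) = w" for w
  proof -
    have "cnj c * (c * w) = (c * cnj c) * w" by (simp only: mult_ac)
    also have "\<dots> = w" unfolding cc by (rule mult_1_left)
    finally show ?thesis .
  qed
  have norm_g: "norm (?g v) = norm v" for v
    by (simp add: cmod_def norm_vec_def L2_set_def sum_2)
  have "orthogonal_transformation T"
    unfolding orthogonal_transformation
  proof
    show "linear T"
      unfolding T_def by (rule linearI) (auto simp: vec_eq_iff forall_2 algebra_simps)
    show "\<forall>v. norm (T v) = norm v"
    proof
      fix v
      have "norm (T v) = norm (?g (T v))" by (simp only: norm_g)
      also have "\<dots> = norm (?g v)" unfolding T_def gh using c by (simp only: norm_mult complex_mod_cnj)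
      finally show "norm (T v) = norm v" by (simp only: norm_g)
    qed
  qed
  fix l u :: complex
  assume lu: "\<And>b. b \<in> Basis \<Longrightarrow> l \<bullet> b \<le> u \<bullet> b"
  let ?B = "?g -` box l u"
  have "?B = box (?h l) (?h u)"
    by (auto simp: in_box_complex_iff mem_box_cart forall_2)
  then have B: "?B \<in> lmeasurable" "?B \<in> sets borel" by simp_all
  have TB: "?g -` ((*) c -` box l u) = T ` ?B"
  proof (intro equalityI subsetI)
    fix v assume "v \<in> ?g -` ((*) c -` box l u)"
    then have "?h (c * ?g v) \<in> ?B" unfolding vimage_eq gh .
    moreover have "T (?h (c * ?g v)) = v"
      unfolding T_def gh cnj_cancel by (rule hg)
    ultimately show "v \<in> T ` ?B" by (rule image_eqI[OF sym, rotated])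
  next
    fix v assume "v \<in> T ` ?B"
    then obtain w where w: "v = T w" "w \<in> ?B" by (rule imageE)
    have "c * ?g v = ?g w" unfolding w T_def gh by (simp only: cc mult_1_left flip: mult.assoc)
    then show "v \<in> ?g -` ((*) c -` box l u)" using w(2) by (simp only: vimage_eq)
  qed
  have *: "emeasure lborel A = emeasure lborel (?g -` A)" if "A \<in> sets borel" for A
  proof -
    have "?g \<in> measurable lborel borel" unfolding measurable_lborel2 by (rule gmeas)
    from emeasure_distr[OF this that] show ?thesis
      unfolding lborel_distr_complex_of_vec space_lborel space_borel Int_UNIV_right .
  qed
  have vimg: "(*) c -` box l u \<in> sets borel"
    by (rule borel_open, rule open_vimage[OF open_box], rule continuous_on_mult_left, rule continuous_on_id)
  have vimg2: "?g -` ((*) c -` box l u) \<in> sets borel"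
    using measurable_sets[OF gmeas vimg] unfolding space_borel Int_UNIV_right .
  have "emeasure (distr lborel borel ((*) c)) (box l u) = emeasure lborel ((*) c -` box l u)"
    by (subst emeasure_distr) auto
  also have "\<dots> = emeasure lborel (T ` ?B)"
    using *[OF vimg] TB by simp
  also have "\<dots> = emeasure lebesgue (T ` ?B)"
    using vimg2 TB by simp
  also have "\<dots> = emeasure lebesgue ?B"
    using measurable_orthogonal_image[OF \<open>orthogonal_transformation T\<close> B(1)]
      measure_orthogonal_image[OF \<open>orthogonal_transformation T\<close> B(1)] B(1)
    by (simp only: emeasure_eq_measure2)
  also have "\<dots> = emeasure lborel ?B" using B by simp
  also have "\<dots> = emeasure lborel (box l u)"
    by (rule *[symmetric]) simp
  also have "\<dots> = (\<Prod>b\<in>Basis. (u - l) \<bullet> b)"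
    using lu by (simp add: emeasure_lborel_box)
  finally show "emeasure (distr lborel borel ((*) c)) (box l u) = (\<Prod>b\<in>Basis. (u - l) \<bullet> b)" .
qed simp

subsection \<open>Lacunary series\<close>

definition lacunary :: "(nat \<Rightarrow> real) \<Rightarrow> complex \<Rightarrow> complex" where
  "lacunary a z = (\<Sum>k. of_real (a k) * z ^ (2 ^ k))"

text \<open>Since \<open>k \<le> 2 ^ k\<close> and \<open>r \<le> 1\<close>, a geometric majorant is
  available. It serves for pointwise and uniform convergence and later for dominated
  convergence.\<close>

lemma norm_lacunary_term_le:
  fixes z :: complex
  assumes "\<bar>a k\<bar> \<le> 1" "norm z \<le> r" "r \<le> 1"
  shows "norm (of_real (a k) * z ^ (2 ^ k) :: complex) \<le> r ^ k"
proof -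
  have "0 \<le> r" using assms(2) norm_ge_zero order_trans by blast
  have "norm (of_real (a k) * z ^ (2 ^ k) :: complex) = \<bar>a k\<bar> * norm z ^ (2 ^ k)"
    by (simp add: norm_mult norm_power)
  also have "\<dots> \<le> 1 * r ^ (2 ^ k)"
    using assms by (intro mult_mono power_mono) auto
  also have "\<dots> \<le> r ^ k"
    using \<open>0 \<le> r\<close> \<open>r \<le> 1\<close> by (simp add: power_decreasing less_imp_le)
  finally show ?thesis .
qed

lemma lacunary_sums:
  fixes z :: complex
  assumes "\<And>k. \<bar>a k\<bar> \<le> 1" "norm z < 1"
  shows "(\<lambda>k. of_real (a k) * z ^ (2 ^ k)) sums lacunary a z"
  unfolding lacunary_def
proof (rule summable_sums, rule summable_comparison_test')
  show "summable (\<lambda>k. norm z ^ k)" using assms by (simp add: summable_geometric)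
  show "norm (of_real (a k) * z ^ (2 ^ k)) \<le> norm z ^ k" for k
    using assms norm_lacunary_term_le[of a k z "norm z"] by simp
qed

lemma uniform_limit_lacunary:
  assumes "\<And>k. \<bar>a k\<bar> \<le> 1" "0 \<le> r" "r < 1"
  shows "uniform_limit (cball 0 r) (\<lambda>n z. \<Sum>k<n. of_real (a k) * z ^ (2 ^ k)) (lacunary a) sequentially"
  unfolding lacunary_def
proof (rule Weierstrass_m_test)
  show "summable (\<lambda>k. r ^ k)" using assms by (simp add: summable_geometric)
  show "norm (of_real (a k) * z ^ (2 ^ k)) \<le> r ^ k" if "z \<in> cball 0 r" for k and z :: complex
    using assms that norm_lacunary_term_le[of a k z r] by simp
qed

lemma holomorphic_lacunary:
  assumes "\<And>k. \<bar>a k\<bar> \<le> 1"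
  shows "lacunary a holomorphic_on ball 0 1"
proof (rule holomorphic_uniform_sequence[OF open_ball])
  show "(\<lambda>z. \<Sum>k<n. of_real (a k) * z ^ (2 ^ k)) holomorphic_on ball 0 1" for n
    by (intro holomorphic_intros)
  fix z :: complex assume z: "z \<in> ball 0 1"
  define d where "d = (1 - norm z) / 2"
  have d: "d > 0" "norm z + d < 1" using z by (auto simp: d_def field_simps)
  have sub: "cball z d \<subseteq> cball 0 (norm z + d)"
  proof
    fix w assume "w \<in> cball z d"
    then have "norm (z - w) \<le> d" by (simp add: dist_norm)
    then show "w \<in> cball 0 (norm z + d)"
      using norm_triangle_ineq2[of w z] by (simp add: norm_minus_commute)
  qed
  moreover have "cball 0 (norm z + d) \<subseteq> ball (0::complex) 1" using d by auto
  moreover have "0 \<le> norm z + d" using d by (simp add: add_nonneg_nonneg)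
  ultimately show "\<exists>d>0. cball z d \<subseteq> ball 0 1 \<and>
      uniform_limit (cball z d) (\<lambda>n z. \<Sum>k<n. of_real (a k) * z ^ (2 ^ k)) (lacunary a) sequentially"
    using d uniform_limit_on_subset[OF uniform_limit_lacunary[OF assms] sub]
    by (intro exI[of _ d] conjI) auto
qed

lemma norm_eq_1_if_power_eq_minus_1:
  fixes \<omega> :: complex
  assumes "\<omega> ^ (2 ^ k) = - 1"
  shows "norm \<omega> = 1"
proof -
  have "norm \<omega> ^ (2 ^ k) = 1 ^ (2 ^ k)" using arg_cong[OF assms, of norm] by (simp add: norm_power)
  then show ?thesis by (rule power_eq_imp_eq_base) simp_all
qed

text \<open>An alternating average over the \<open>2 ^ (k + 1)\<close>-th roots of unity isolates the \<open>k\<close>-th term,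
  because \<open>- (\<omega> ^ (2 ^ j)) = 1\<close> only for \<open>j = k\<close>.\<close>
lemma lacunary_average:
  fixes \<omega> :: complex
  assumes a: "\<And>k. \<bar>a k\<bar> \<le> 1" and \<omega>: "\<omega> ^ (2 ^ k) = - 1" and z: "norm z < 1"
  shows "(\<Sum>i<2 ^ Suc k. (- 1) ^ i * lacunary a (\<omega> ^ i * z)) = 2 ^ Suc k * (of_real (a k) * z ^ (2 ^ k))"
proof -
  note norm_\<omega> = norm_eq_1_if_power_eq_minus_1[OF \<omega>]
  \<comment> \<open>Averaging the \<open>j\<close>-th term produces a geometric sum with this ratio.
    Its \<open>2 ^ Suc k\<close>-th power is 1, so the sum vanishes unless the ratio itself is
    1.\<close>
  let ?\<rho> = "\<lambda>j. - (\<omega> ^ (2 ^ j))"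
  have \<rho>: "(\<Sum>i<2 ^ Suc k. ?\<rho> j ^ i) = (if j = k then 2 ^ Suc k else 0)" for j
  proof (cases "j = k")
    case True
    then show ?thesis using \<omega> by simp
  next
    case False
    have one: "\<omega> ^ (2 ^ l) = 1" if "k < l" for l
    proof -
      have "(2::nat) ^ l = 2 ^ k * 2 * 2 ^ (l - Suc k)"
        using that by (metis Suc_leI le_add_diff_inverse power_Suc2 power_add)
      then show ?thesis by (simp add: power_mult \<omega>)
    qed
    \<comment> \<open>For \<open>j > k\<close> the value is an even power of -1, hence 1; for
      \<open>j < k\<close> the value -1 would in the same way force
      \<open>\<omega> ^ (2 ^ k) = 1\<close>.\<close>
    have "\<omega> ^ (2 ^ j) \<noteq> - 1"
    proof
      assume j: "\<omega> ^ (2 ^ j) = - 1"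
      then have "j < k" using one[of j] False by fastforce
      then have "(2::nat) ^ k = 2 ^ j * 2 * 2 ^ (k - Suc j)"
        by (metis Suc_leI le_add_diff_inverse power_Suc2 power_add)
      then have "\<omega> ^ (2 ^ k) = 1" by (simp add: power_mult j)
      then show False using \<omega> by simp
    qed
    then have ne: "?\<rho> j \<noteq> 1" by (metis minus_minus)
    have "?\<rho> j ^ (2 ^ Suc k) = (\<omega> ^ (2 ^ Suc k)) ^ (2 ^ j)"
      by (simp add: power_minus_even power_mult[symmetric] mult.commute)
    also have "\<dots> = 1" using one[of "Suc k"] by simp
    finally show ?thesis using False ne by (simp add: sum_gp_strict)
  qed
  have "(\<lambda>j. \<Sum>i<2 ^ Suc k. (- 1) ^ i * (of_real (a j) * (\<omega> ^ i * z) ^ (2 ^ j))) sums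
      (\<Sum>i<2 ^ Suc k. (- 1) ^ i * lacunary a (\<omega> ^ i * z))"
    using norm_\<omega> z
    by (intro sums_sum sums_mult lacunary_sums a) (auto simp: norm_mult norm_power)
  moreover have "(\<Sum>i<2 ^ Suc k. (- 1) ^ i * (of_real (a j) * (\<omega> ^ i * z) ^ (2 ^ j))) =
      (if j = k then 2 ^ Suc k * (of_real (a k) * z ^ (2 ^ k)) else 0)" for j
  proof -
    have "(- 1) ^ i * (of_real (a j) * (\<omega> ^ i * z) ^ (2 ^ j)) = ?\<rho> j ^ i * (of_real (a j) * z ^ (2 ^ j))" for i
    proof -
      have "(\<omega> ^ i) ^ (2 ^ j) = (\<omega> ^ (2 ^ j)) ^ i"
        by (simp add: power_mult[symmetric] mult.commute)
      then show ?thesis by (simp add: power_mult_distrib power_minus[of "\<omega> ^ (2 ^ j)"])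
    qed
    then have "(\<Sum>i<2 ^ Suc k. (- 1) ^ i * (of_real (a j) * (\<omega> ^ i * z) ^ (2 ^ j))) =
        (\<Sum>i<2 ^ Suc k. ?\<rho> j ^ i) * (of_real (a j) * z ^ (2 ^ j))"
      by (simp only: sum_distrib_right)
    then show ?thesis unfolding \<rho> by simp
  qed
  ultimately have "(\<lambda>j. if j = k then 2 ^ Suc k * (of_real (a k) * z ^ (2 ^ k)) else 0) sums
      (\<Sum>i<2 ^ Suc k. (- 1) ^ i * lacunary a (\<omega> ^ i * z))" by simp
  then show ?thesis
    by (rule sums_unique2) (rule sums_single)
qed

text \<open>Differentiating the averaging identity gives this: both sides are derivatives at
  \<open>z\<close> of functions that agree near \<open>z\<close>. The extra factors
  \<open>\<omega> ^ i\<close> come from the chain rule and have modulus 1.\<close>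

lemma lacunary_deriv_average:
  fixes \<omega> :: complex
  assumes a: "\<And>k. \<bar>a k\<bar> \<le> 1" and \<omega>: "\<omega> ^ (2 ^ k) = - 1" and z: "norm z < 1"
  shows "(\<Sum>i<2 ^ Suc k. (- 1) ^ i * (\<omega> ^ i * deriv (lacunary a) (\<omega> ^ i * z))) =
    2 ^ Suc k * (of_real (a k) * (2 ^ k * z ^ (2 ^ k - 1)))"
proof (rule DERIV_unique)
  note norm_\<omega> = norm_eq_1_if_power_eq_minus_1[OF \<omega>]
  have "(lacunary a has_field_derivative deriv (lacunary a) (\<omega> ^ i * z)) (at (\<omega> ^ i * z))" for i
    using z norm_\<omega>
    by (intro holomorphic_derivI[OF holomorphic_lacunary[OF a]]) (auto simp: norm_mult norm_power)
  then have "((\<lambda>z. lacunary a (\<omega> ^ i * z)) has_field_derivative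
      \<omega> ^ i * deriv (lacunary a) (\<omega> ^ i * z)) (at z)" for i
    by (rule DERIV_chain'[THEN DERIV_cong, rotated]) (auto intro!: derivative_eq_intros)
  then show "((\<lambda>z. \<Sum>i<2 ^ Suc k. (- 1) ^ i * lacunary a (\<omega> ^ i * z)) has_field_derivative
      (\<Sum>i<2 ^ Suc k. (- 1) ^ i * (\<omega> ^ i * deriv (lacunary a) (\<omega> ^ i * z)))) (at z)"
    by (intro DERIV_sum DERIV_cmult)
  have "((\<lambda>z. 2 ^ Suc k * (of_real (a k) * z ^ (2 ^ k))) has_field_derivative
      2 ^ Suc k * (of_real (a k) * (2 ^ k * z ^ (2 ^ k - 1)))) (at z)"
    by (auto intro!: derivative_eq_intros)
  moreover have "\<forall>\<^sub>F w in nhds z. w \<in> ball 0 1"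
    using z by (intro eventually_nhds_in_open) auto
  then have "\<forall>\<^sub>F w in nhds z. 2 ^ Suc k * (of_real (a k) * w ^ (2 ^ k)) =
      (\<Sum>i<2 ^ Suc k. (- 1) ^ i * lacunary a (\<omega> ^ i * w))"
    by eventually_elim (use lacunary_average[OF a \<omega>] in auto)
  ultimately show "((\<lambda>z. \<Sum>i<2 ^ Suc k. (- 1) ^ i * lacunary a (\<omega> ^ i * z)) has_field_derivative
      2 ^ Suc k * (of_real (a k) * (2 ^ k * z ^ (2 ^ k - 1)))) (at z)"
    by (subst (asm) DERIV_cong_ev[OF refl _ refl])
qed

subsection \<open>The derivative and the Bergman space\<close>

text \<open>Here \<open>norm z ^ (2 ^ k - 1)\<close> stays above a positive constant while the area
  is still of order \<open>1 / 2 ^ k\<close>. For \<open>k = 0\<close> the removed ball is empty, so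
  the origin is included.\<close>

definition annulus :: "nat \<Rightarrow> complex set" where
  "annulus k = ball 0 (1 - 1 / 2 ^ Suc k) - ball 0 (1 - 1 / 2 ^ k)"

lemma annulus_subset: "annulus k \<subseteq> ball 0 1"
proof
  fix z assume "z \<in> annulus k"
  then have "norm z < 1 - 1 / 2 ^ Suc k" by (simp add: annulus_def)
  also have "\<dots> < 1" by simp
  finally show "z \<in> ball 0 1" by simp
qed

lemma annulus_iff: "z \<in> annulus k \<longleftrightarrow> 1 - 1 / 2 ^ k \<le> norm z \<and> norm z < 1 - 1 / 2 ^ Suc k"
  by (auto simp: annulus_def)

lemma sets_annulus [measurable]: "annulus k \<in> sets borel"
  by (simp add: annulus_def)

lemma disjoint_family_annulus: "disjoint_family annulus"
proof -
  have "annulus j \<inter> annulus k = {}" if "j < k" for j k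
  proof -
    have "(2::real) ^ Suc j \<le> 2 ^ k" using that by (intro power_increasing) auto
    then have "1 - 1 / 2 ^ Suc j \<le> (1 - 1 / 2 ^ k :: real)"
      by (intro diff_left_mono divide_left_mono) auto
    then show ?thesis by (force simp: annulus_iff)
  qed
  then show ?thesis
    unfolding disjoint_family_on_def by (metis Int_commute linorder_neqE_nat)
qed

text \<open>With inner radius \<open>r\<close> and outer radius \<open>s\<close> the area is
  \<open>pi * (s - r) * (s + r)\<close>, where \<open>s - r = 1 / 2 ^ Suc k\<close> and
  \<open>s + r\<close> is at least \<open>1 / 2\<close>.\<close>

lemma emeasure_annulus: "emeasure lborel (annulus k) \<ge> ennreal (pi / 2 ^ Suc (Suc k))"
proof -
  let ?r = "1 - 1 / 2 ^ k :: real" and ?s = "1 - 1 / 2 ^ Suc k :: real"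
  have r: "0 \<le> ?r" by simp
  have rs: "?r \<le> ?s" by (intro diff_left_mono divide_left_mono) auto
  have "emeasure lborel (annulus k) = emeasure lborel (ball 0 ?s :: complex set) - emeasure lborel (ball 0 ?r :: complex set)"
    unfolding annulus_def using rs emeasure_bounded_finite[OF bounded_ball, of "0::complex" ?r]
    by (intro emeasure_Diff) auto
  also have "\<dots> = ennreal (pi * ?s ^ 2 - pi * ?r ^ 2)"
    using r rs by (simp only: emeasure_ball[OF r] emeasure_ball[OF order_trans[OF r rs]])
      (simp add: unit_ball_vol_2 ennreal_minus)
  also have "\<dots> \<ge> ennreal (pi / 2 ^ Suc (Suc k))"
  proof (rule ennreal_leI)
    have "?s - ?r = 1 / 2 ^ Suc k" by (simp add: field_simps)
    moreover have "1 / 2 ^ Suc k \<le> (1 / 2 :: real)" by simp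
    then have "1 / 2 \<le> ?s + ?r" using r by linarith
    ultimately have "1 / 2 ^ Suc k * (1 / 2) \<le> (?s - ?r) * (?s + ?r)"
      using mult_left_mono[of "1/2" "?s + ?r" "1 / 2 ^ Suc k"] by simp
    then have "pi * (1 / 2 ^ Suc k * (1 / 2)) \<le> pi * ((?s - ?r) * (?s + ?r))"
      by (intro mult_left_mono) auto
    then show "pi / 2 ^ Suc (Suc k) \<le> pi * ?s ^ 2 - pi * ?r ^ 2"
      by (simp add: power2_eq_square algebra_simps)
  qed
  finally show ?thesis .
qed

text \<open>For \<open>n = Suc m\<close> with \<open>m > 0\<close> the base is the inverse of
  \<open>1 + 1 / m\<close>, and \<open>(1 + 1 / m) ^ m \<le> exp 1\<close>. For
  \<open>n \<le> 1\<close> the truncated exponent is 0 and the power is 1.\<close>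

lemma exp_minus_one_le_power: "exp (- 1) \<le> (1 - 1 / real n) ^ (n - 1)"
proof (cases "n \<le> 1")
  case True
  then show ?thesis by simp
next
  case False
  define m where "m = n - 1"
  have m: "m > 0" "n = Suc m" using False by (auto simp: m_def)
  have "(1 + 1 / real m) ^ m \<le> exp (1 / real m) ^ m"
    by (intro power_mono exp_ge_add_one_self) auto
  also have "\<dots> = exp (real m * (1 / real m))" by (rule exp_of_nat_mult[symmetric])
  also have "\<dots> = exp 1" using m by simp
  finally have "inverse (exp 1) \<le> inverse ((1 + 1 / real m) ^ m)"
    using m by (intro le_imp_inverse_le zero_less_power) (auto intro: add_pos_pos)
  also have "\<dots> = inverse (1 + 1 / real m) ^ m" by (rule power_inverse[symmetric])
  also have "inverse (1 + 1 / real m) = 1 - 1 / real n"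
    using m by (simp add: field_simps)
  finally have "inverse (exp 1) \<le> (1 - 1 / real n) ^ (n - 1)" using m by simp
  then show ?thesis by (simp add: exp_minus)
qed

lemma nn_integral_rotate:
  fixes c :: complex
  assumes c: "norm c = 1" and h: "h \<in> borel_measurable borel"
  shows "(\<integral>\<^sup>+z. h (c * z) \<partial>lborel) = (\<integral>\<^sup>+z. h z \<partial>lborel)"
proof -
  have "(\<integral>\<^sup>+z. h z \<partial>distr lborel borel ((*) c)) = (\<integral>\<^sup>+z. h (c * z) \<partial>lborel)"
    by (rule nn_integral_distr) (use h in simp_all)
  then show ?thesis by (simp only: lborel_distr_complex_mult[OF c])
qed

text \<open>By the averaging identity and the triangle inequality, the values of
  \<open>norm (deriv (lacunary a))\<close> at the \<open>2 ^ Suc k\<close> rotations of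
  \<open>z\<close> add up to at least \<open>2 ^ Suc k * exp (- 1) * a k * 2 ^ k\<close>. All
  rotations contribute the same integral over the annulus, and the factor \<open>2 ^ k\<close>
  cancels against the area. Measurability is assumed for the function cut off to the disc, which is
  what \<open>set_integrable\<close> provides.\<close>

lemma nn_integral_deriv_lacunary_annulus:
  assumes a: "\<And>k. 0 \<le> a k" "\<And>k. a k \<le> 1"
    and meas: "(\<lambda>z. indicator (ball 0 1) z *\<^sub>R deriv (lacunary a) z) \<in> borel_measurable borel"
  shows "ennreal (a k * (exp (- 1) * pi / 4)) \<le> (\<integral>\<^sup>+z\<in>annulus k. ennreal (norm (deriv (lacunary a) z)) \<partial>lborel)"
proof -
  have a': "\<bar>a k\<bar> \<le> 1" for k using a[of k] by simp
  define \<omega> where "\<omega> = cis (pi / 2 ^ k)"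
  have \<omega>: "\<omega> ^ (2 ^ k) = - 1" 
  proof -
    have "\<omega> ^ (2 ^ k) = cis (real (2 ^ k) * (pi / 2 ^ k))" unfolding \<omega>_def by (rule Complex.DeMoivre)
    also have "real (2 ^ k) * (pi / 2 ^ k) = pi" by simp
    finally show ?thesis by simp
  qed
  have norm_\<omega>: "norm \<omega> = 1" by (simp add: \<omega>_def)
  define h where "h z = ennreal (norm (deriv (lacunary a) z)) * indicator (annulus k) z" for z
  define F where "F = (\<lambda>z. indicator (ball 0 1) z *\<^sub>R deriv (lacunary a) z)"
  have [measurable]: "F \<in> borel_measurable borel" using meas unfolding F_def .
  have "h = (\<lambda>z. ennreal (norm (F z)) * indicator (annulus k) z)"
    using annulus_subset[of k] by (auto simp: h_def F_def indicator_def fun_eq_iff)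
  then have h_meas [measurable]: "h \<in> borel_measurable borel" by simp
  let ?c = "exp (- 1) * (a k * 2 ^ k)"
  have c_nonneg: "0 \<le> ?c" using a[of k] by simp
  have pow2: "ennreal (2 ^ Suc k) = 2 ^ Suc k"
    by (subst ennreal_power[symmetric]) simp_all
  have "2 ^ Suc k * ennreal ?c * indicator (annulus k) z \<le> (\<Sum>i<2 ^ Suc k. h (\<omega> ^ i * z))" for z
  proof (cases "z \<in> annulus k")
    case True
    have z: "norm z < 1" "1 - 1 / 2 ^ k \<le> norm z" using True annulus_subset[of k] by (auto simp: annulus_iff)
    have rot: "\<omega> ^ i * z \<in> annulus k" for i
      using True norm_\<omega> by (simp add: annulus_iff norm_mult norm_power)
    have "exp (- 1) \<le> (1 - 1 / 2 ^ k :: real) ^ (2 ^ k - 1)"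
      using exp_minus_one_le_power[of "2 ^ k"] by simp
    also have "\<dots> \<le> norm z ^ (2 ^ k - 1)" using z by (intro power_mono) auto
    finally have "2 ^ Suc k * ?c \<le> 2 ^ Suc k * (norm z ^ (2 ^ k - 1) * (a k * 2 ^ k))"
      using a by (intro mult_left_mono mult_right_mono) auto
    also have "\<dots> = norm (2 ^ Suc k * (of_real (a k) * (2 ^ k * z ^ (2 ^ k - 1))))"
      using a[of k] by (simp add: norm_mult norm_power)
    also have "\<dots> = norm (\<Sum>i<2 ^ Suc k. (- 1) ^ i * (\<omega> ^ i * deriv (lacunary a) (\<omega> ^ i * z)))"
      using lacunary_deriv_average[OF a' \<omega> z(1)] by simp
    also have "\<dots> \<le> (\<Sum>i<2 ^ Suc k. norm (deriv (lacunary a) (\<omega> ^ i * z)))"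
      using norm_\<omega> by (intro sum_norm_le) (simp add: norm_mult norm_power)
    finally have "ennreal (2 ^ Suc k * ?c) \<le> ennreal (\<Sum>i<2 ^ Suc k. norm (deriv (lacunary a) (\<omega> ^ i * z)))"
      by (rule ennreal_leI)
    also have "\<dots> = (\<Sum>i<2 ^ Suc k. h (\<omega> ^ i * z))"
      using rot by (simp add: h_def sum_ennreal)
    finally show ?thesis
      unfolding ennreal_mult''[OF c_nonneg] pow2 using True by simp
  qed simp
  then have "(\<integral>\<^sup>+z. 2 ^ Suc k * ennreal ?c * indicator (annulus k) z \<partial>lborel) \<le> (\<integral>\<^sup>+z. (\<Sum>i<2 ^ Suc k. h (\<omega> ^ i * z)) \<partial>lborel)"
    by (intro nn_integral_mono) auto
  also have "\<dots> = (\<Sum>i<2 ^ Suc k. \<integral>\<^sup>+z. h (\<omega> ^ i * z) \<partial>lborel)"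
    by (rule nn_integral_sum) measurable
  also have "\<dots> = 2 ^ Suc k * (\<integral>\<^sup>+z. h z \<partial>lborel)"
    using norm_\<omega> by (subst nn_integral_rotate) (auto simp: norm_power)
  finally have "2 ^ Suc k * (ennreal ?c * emeasure lborel (annulus k)) \<le> 2 ^ Suc k * (\<integral>\<^sup>+z. h z \<partial>lborel)"
    by (subst (asm) nn_integral_cmult_indicator) (simp_all add: mult.assoc)
  then have "ennreal ?c * emeasure lborel (annulus k) \<le> (\<integral>\<^sup>+z. h z \<partial>lborel)"
    by (subst (asm) ennreal_mult_le_mult_iff) (simp, metis pow2 ennreal_neq_top, assumption)
  moreover have "ennreal ?c * ennreal (pi / 2 ^ Suc (Suc k)) \<le> ennreal ?c * emeasure lborel (annulus k)"
    by (intro mult_left_mono emeasure_annulus) auto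
  moreover have "ennreal ?c * ennreal (pi / 2 ^ Suc (Suc k)) = ennreal (a k * (exp (- 1) * pi / 4))"
    using a[of k] by (subst ennreal_mult[symmetric]) (auto simp: field_simps)
  ultimately show ?thesis unfolding h_def by simp
qed

text \<open>The annuli are disjoint subsets of the disc, so their lower bounds add up: integrability
  would make a positive multiple of \<open>a\<close> summable.\<close>

lemma deriv_lacunary_notin_bergman:
  assumes a: "\<And>k. 0 \<le> a k" "\<And>k. a k \<le> 1" and "\<not> summable a"
  shows "deriv (lacunary a) \<notin> bergman_space1"
proof
  define F where "F = (\<lambda>z. indicator (ball 0 1) z *\<^sub>R deriv (lacunary a) z)"
  assume "deriv (lacunary a) \<in> bergman_space1"
  then have int: "integrable lborel F"
    by (simp add: bergman_space1_def set_integrable_def F_def)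
  then have meas [measurable]: "F \<in> borel_measurable borel" by auto
  let ?h = "\<lambda>z. ennreal (norm (F z))"
  let ?c = "exp (- 1) * pi / 4 :: real"
  have "(\<Sum>k. ennreal (a k * ?c)) \<le> (\<Sum>k. \<integral>\<^sup>+z\<in>annulus k. ?h z \<partial>lborel)"
  proof (intro suminf_le allI)
    fix k
    have "(\<integral>\<^sup>+z\<in>annulus k. ennreal (norm (deriv (lacunary a) z)) \<partial>lborel) = (\<integral>\<^sup>+z\<in>annulus k. ?h z \<partial>lborel)"
      using annulus_subset[of k] by (intro nn_integral_cong) (auto simp: indicator_def F_def)
    then show "ennreal (a k * ?c) \<le> (\<integral>\<^sup>+z\<in>annulus k. ?h z \<partial>lborel)"
      using nn_integral_deriv_lacunary_annulus[of a k] a meas unfolding F_def by simp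
  qed auto
  also have "\<dots> = (\<integral>\<^sup>+z\<in>(\<Union>k. annulus k). ?h z \<partial>lborel)"
    using meas by (intro nn_integral_disjoint_family[symmetric] disjoint_family_annulus) auto
  also have "\<dots> \<le> (\<integral>\<^sup>+z. ?h z \<partial>lborel)"
    by (intro nn_integral_mono) (auto simp: indicator_def)
  also have "\<dots> < \<infinity>" using int by (simp add: integrable_iff_bounded)
  finally have "summable (\<lambda>k. a k * ?c)"
    using a by (intro summable_suminf_not_top) auto
  then have "summable a" by (simp only: mult.commute[of _ ?c] summable_cmult_iff) simp
  with assms show False by blast
qed

subsection \<open>Means of lacunary polynomials on the unit circle\<close>

lemma has_integral_cis_power:
  "((\<lambda>t. cis t ^ Suc n) has_integral 0) {0..2 * pi}"
proof -
  let ?F = "\<lambda>t. cis (real (Suc n) * t) / (\<i> * of_nat (Suc n))"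
  have "((\<lambda>t. cis (real (Suc n) * t)) has_integral ?F (2 * pi) - ?F 0) {0..2 * pi}"
  proof (rule fundamental_theorem_of_calculus)
    fix t :: real
    show "(?F has_vector_derivative cis (real (Suc n) * t)) (at t within {0..2 * pi})"
      unfolding has_vector_derivative_def
      by (auto intro!: derivative_eq_intros simp: fun_eq_iff scaleR_conv_of_real field_simps
          simp del: of_nat_Suc)
  qed simp
  moreover have "cis (real (Suc n) * (2 * pi)) = 1"
  proof -
    have "cis (real (Suc n) * (2 * pi)) = cis (2 * pi) ^ Suc n" by (rule Complex.DeMoivre[symmetric])
    then show ?thesis by simp
  qed
  ultimately show ?thesis by (simp only: Complex.DeMoivre) simp
qed

text \<open>Only positive frequencies occur, and each integrates to 0. The exponent \<open>n\<close>
  is arbitrary because peeling off a coefficient of \<open>q\<close> raises it by one.\<close>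

lemma has_integral_poly_cis_power:
  "((\<lambda>t. poly q (cis t) * cis t ^ Suc n) has_integral 0) {0..2 * pi}"
proof (induction q arbitrary: n)
  case 0
  show ?case by simp
next
  case (pCons a q)
  have "((\<lambda>t. a * cis t ^ Suc n + poly q (cis t) * cis t ^ Suc (Suc n)) has_integral (a * 0 + 0)) {0..2 * pi}"
    by (intro has_integral_add has_integral_mult_right has_integral_cis_power pCons.IH)
  then show ?case by (simp add: algebra_simps)
qed

text \<open>The squared \<open>L^2\<close> norm for normalised arc length; by Parseval it is the sum
  of the squared moduli of the coefficients.\<close>

definition circle_mean_sq :: "complex poly \<Rightarrow> real" where
  "circle_mean_sq q = integral {0..2 * pi} (\<lambda>t. (norm (poly q (cis t)))\<^sup>2) / (2 * pi)"

lemma integrable_norm_poly_cis: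
  "(\<lambda>t. (norm (poly q (cis t))) ^ k) integrable_on {0..2 * pi}"
  by (intro integrable_continuous_real continuous_intros)

lemma circle_mean_sq_0 [simp]: "circle_mean_sq 0 = 0"
  by (simp add: circle_mean_sq_def)

lemma circle_mean_sq_1 [simp]: "circle_mean_sq 1 = 1"
  by (simp add: circle_mean_sq_def)

lemma circle_mean_sq_smult: "circle_mean_sq (smult c q) = (norm c)\<^sup>2 * circle_mean_sq q"
  by (simp add: circle_mean_sq_def norm_mult power_mult_distrib)

text \<open>Parseval for one coefficient: the cross term is the real part of a multiple of
  \<open>z * q z\<close>, which has mean 0 on the circle.\<close>

lemma circle_mean_sq_pCons: "circle_mean_sq (pCons a q) = (norm a)\<^sup>2 + circle_mean_sq q"
proof -
  have "(norm (a + w * z))\<^sup>2 = (norm a)\<^sup>2 + (norm w)\<^sup>2 + 2 * Re (cnj a * (w * z))"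
    if "norm z = 1" for w z :: complex
  proof -
    have "(norm (a + w * z))\<^sup>2 = (norm a)\<^sup>2 + (norm (w * z))\<^sup>2 + 2 * Re (cnj a * (w * z))"
      unfolding cmod_power2 by (simp add: power2_eq_square algebra_simps)
    then show ?thesis using that by (simp add: norm_mult)
  qed
  then have *: "(norm (poly (pCons a q) (cis t)))\<^sup>2 =
      ((norm a)\<^sup>2 + (norm (poly q (cis t)))\<^sup>2) + 2 * Re (cnj a * (poly q (cis t) * cis t ^ Suc 0))" for t
    by (simp add: mult.commute[of "cis t"])
  have "((\<lambda>t. 2 * Re (cnj a * (poly q (cis t) * cis t ^ Suc 0))) has_integral 2 * Re (cnj a * 0)) {0..2 * pi}"
    by (intro has_integral_mult_right has_integral_Re has_integral_poly_cis_power)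
  moreover have "((\<lambda>t. (norm a)\<^sup>2 + (norm (poly q (cis t)))\<^sup>2) has_integral
      ((2 * pi) * (norm a)\<^sup>2 + integral {0..2 * pi} (\<lambda>t. (norm (poly q (cis t)))\<^sup>2))) {0..2 * pi}"
    using has_integral_const_real[of "(norm a)\<^sup>2" 0 "2 * pi"]
    by (intro has_integral_add integrable_integral integrable_norm_poly_cis) auto
  ultimately have "((\<lambda>t. (norm (poly (pCons a q) (cis t)))\<^sup>2) has_integral
      ((2 * pi) * (norm a)\<^sup>2 + integral {0..2 * pi} (\<lambda>t. (norm (poly q (cis t)))\<^sup>2)) + 2 * Re (cnj a * 0)) {0..2 * pi}"
    unfolding * by (rule has_integral_add[rotated])
  then show ?thesis
    by (simp add: circle_mean_sq_def integral_unique add_divide_distrib)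
qed

text \<open>The summands are orthogonal because the frequencies of \<open>q\<close> lie below
  \<open>n\<close> and those of the other summand do not. The induction strips the coefficients of
  \<open>q\<close> one at a time.\<close>

lemma circle_mean_sq_shift:
  assumes "\<And>i. i \<ge> n \<Longrightarrow> coeff q i = 0"
  shows "circle_mean_sq (q + monom 1 n * r) = circle_mean_sq q + circle_mean_sq r"
  using assms
proof (induction n arbitrary: q)
  case 0
  then have "q = 0" by (intro poly_eqI) simp
  then show ?case by (simp add: monom_0 flip: one_pCons)
next
  case (Suc n)
  obtain a q' where q: "q = pCons a q'" by (cases q)
  have "coeff q' i = 0" if "i \<ge> n" for i
    using Suc.prems[of "Suc i"] that by (simp add: q)
  then have "circle_mean_sq (q' + monom 1 n * r) = circle_mean_sq q' + circle_mean_sq r"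
    by (rule Suc.IH)
  moreover have "q + monom 1 (Suc n) * r = pCons a (q' + monom 1 n * r)"
    by (simp add: q monom_Suc)
  ultimately show ?case by (simp add: q circle_mean_sq_pCons)
qed

lemma circle_mean_sq_sum_shift:
  assumes "\<And>j i. i \<ge> n \<Longrightarrow> coeff (q j) i = 0"
  shows "circle_mean_sq (\<Sum>j\<le>J. monom 1 (n * j) * q j) = (\<Sum>j\<le>J. circle_mean_sq (q j))"
  using assms
proof (induction J arbitrary: q)
  case 0
  then show ?case by (simp add: monom_0 flip: one_pCons)
next
  case (Suc J)
  have "(\<Sum>j\<le>Suc J. monom 1 (n * j) * q j) = q 0 + monom 1 n * (\<Sum>j\<le>J. monom 1 (n * j) * q (Suc j))"
    by (simp add: sum.atMost_Suc_shift sum_distrib_left mult.assoc[symmetric] mult_monom monom_0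
        del: sum.atMost_Suc flip: one_pCons)
  then show ?case
    using Suc.IH[of "\<lambda>j. q (Suc j)"] Suc.prems
    by (simp add: circle_mean_sq_shift sum.atMost_Suc_shift del: sum.atMost_Suc)
qed

text \<open>In the binomial expansion the term with \<open>j\<close> factors
  \<open>monom c n\<close> only has frequencies from \<open>n * j\<close> up to
  \<open>n * j + l * degree P\<close>, which is less than \<open>n * Suc j\<close>. The terms
  therefore occupy disjoint blocks and are orthogonal.\<close>

lemma circle_mean_sq_binomial:
  assumes "l * degree P < n"
  shows "circle_mean_sq ((monom c n + P) ^ l) =
    (\<Sum>j\<le>l. (real (l choose j))\<^sup>2 * (norm c)\<^sup>2 ^ j * circle_mean_sq (P ^ (l - j)))"
proof -
  define q where "q j = smult (of_nat (l choose j) * c ^ j) (P ^ (l - j))" for j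
  have "monom c n ^ j = smult (c ^ j) (monom 1 (n * j))" for j
    by (simp add: monom_power smult_monom mult.commute)
  then have "(monom c n + P) ^ l = (\<Sum>j\<le>l. monom 1 (n * j) * q j)"
    unfolding binomial_ring q_def
    by (intro sum.cong refl) (simp add: of_nat_poly mult.commute)
  moreover have "coeff (q j) i = 0" if "i \<ge> n" for i j
  proof (rule coeff_eq_0)
    have "degree (q j) \<le> degree (P ^ (l - j))" unfolding q_def by (rule degree_smult_le)
    also have "\<dots> \<le> degree P * (l - j)" by (rule degree_power_le)
    also have "\<dots> \<le> l * degree P" by simp
    finally show "degree (q j) < i" using assms that by linarith
  qed
  ultimately have "circle_mean_sq ((monom c n + P) ^ l) = (\<Sum>j\<le>l. circle_mean_sq (q j))"
    by (simp only: circle_mean_sq_sum_shift)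
  then show ?thesis
    by (simp add: q_def circle_mean_sq_smult norm_mult norm_power
        power_mult_distrib power_mult[symmetric] mult.commute)
qed

text \<open>A Khinchin-type bound for an even exponent \<open>2 * l\<close>. The gap condition makes
  the top monomial dominate the degree of all earlier powers, so the orthogonal expansion applies,
  and the binomial theorem reassembles the estimated terms.\<close>

lemma circle_mean_sq_lacunary_power:
  fixes e :: "nat \<Rightarrow> nat"
  assumes e0: "0 < e 0" and e: "\<And>k. m * e k < e (Suc k)" and "l \<le> m"
  shows "circle_mean_sq ((\<Sum>k<K. monom (c k) (e k)) ^ l) \<le> fact l * (\<Sum>k<K. (norm (c k))\<^sup>2) ^ l"
  using \<open>l \<le> m\<close>
proof (induction K arbitrary: l)
  case 0
  then show ?case by (cases l) auto
next
  case (Suc K)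
  let ?P = "\<Sum>k<K. monom (c k) (e k)" and ?s = "\<Sum>k<K. (norm (c k))\<^sup>2"
  have deg: "l * degree ?P < e K"
  proof (cases "l = 0 \<or> K = 0")
    case True
    have "0 < e K" using e0 e by (cases K) (auto dest: le_less_trans[OF le0])
    then show ?thesis using True by auto
  next
    case False
    then obtain K' where K': "K = Suc K'" by (cases K) auto
    have mono: "e i \<le> e j" if "i \<le> j" for i j
      using that
    proof (induction rule: dec_induct)
      case (step j)
      have "e j \<le> m * e j" using False Suc.prems by (cases m) auto
      then show ?case using step e[of j] by linarith
    qed simp
    have "degree ?P \<le> e K'"
      using K' by (intro degree_sum_le) (auto intro!: order_trans[OF degree_monom_le] mono)
    then have "l * degree ?P \<le> m * e K'" using Suc.prems by (intro mult_le_mono) auto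
    also have "\<dots> < e K" using e[of K'] K' by simp
    finally show ?thesis .
  qed
  have "circle_mean_sq ((\<Sum>k<Suc K. monom (c k) (e k)) ^ l) = circle_mean_sq ((monom (c K) (e K) + ?P) ^ l)"
    by (simp add: add.commute)
  also have "\<dots> = (\<Sum>j\<le>l. (real (l choose j))\<^sup>2 * (norm (c K))\<^sup>2 ^ j * circle_mean_sq (?P ^ (l - j)))"
    using deg by (rule circle_mean_sq_binomial)
  also have "\<dots> \<le> (\<Sum>j\<le>l. fact l * (real (l choose j) * (norm (c K))\<^sup>2 ^ j * ?s ^ (l - j)))"
  proof (intro sum_mono)
    fix j assume j: "j \<in> {..l}"
    \<comment> \<open>The expansion contains \<open>l choose j\<close> squared. One copy times
      \<open>fact (l - j)\<close> from the induction hypothesis is at most \<open>fact l\<close>;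
      the other is kept for the binomial theorem.\<close>
    have "(l choose j) * fact (l - j) \<le> (fact j * fact (l - j) * (l choose j) :: nat)"
      using fact_ge_1[of j, where 'a = nat] by (simp add: mult_ac)
    also have "\<dots> = fact l" using j by (intro binomial_fact_lemma) simp
    finally have "real ((l choose j) * fact (l - j)) \<le> real (fact l)" by (rule of_nat_mono)
    then have "real (l choose j) * fact (l - j) \<le> fact l" by simp
    then have "real (l choose j) * (norm (c K))\<^sup>2 ^ j * ?s ^ (l - j) * (real (l choose j) * fact (l - j))
        \<le> real (l choose j) * (norm (c K))\<^sup>2 ^ j * ?s ^ (l - j) * fact l"
      by (intro mult_left_mono mult_nonneg_nonneg zero_le_power sum_nonneg) auto
    moreover have "circle_mean_sq (?P ^ (l - j)) \<le> fact (l - j) * ?s ^ (l - j)"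
      using Suc.prems by (intro Suc.IH) simp
    then have "(real (l choose j))\<^sup>2 * (norm (c K))\<^sup>2 ^ j * circle_mean_sq (?P ^ (l - j))
        \<le> (real (l choose j))\<^sup>2 * (norm (c K))\<^sup>2 ^ j * (fact (l - j) * ?s ^ (l - j))"
      by (intro mult_left_mono) auto
    ultimately show "(real (l choose j))\<^sup>2 * (norm (c K))\<^sup>2 ^ j * circle_mean_sq (?P ^ (l - j))
        \<le> fact l * (real (l choose j) * (norm (c K))\<^sup>2 ^ j * ?s ^ (l - j))"
      by (simp add: power2_eq_square mult_ac)
  qed
  also have "\<dots> = fact l * (\<Sum>k<Suc K. (norm (c k))\<^sup>2) ^ l"
    by (simp add: add.commute[of _ "(norm (c K))\<^sup>2"] binomial_ring sum_distrib_left)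
  finally show ?case .
qed

text \<open>Every summand is at most the largest one, whose power occurs on the right. The constant
  is crude but independent of \<open>x\<close>.\<close>

lemma power_sum_le_power_card_mult_sum:
  fixes x :: "'a \<Rightarrow> real"
  assumes "finite A" "\<And>i. i \<in> A \<Longrightarrow> 0 \<le> x i" "0 < k"
  shows "(\<Sum>i\<in>A. x i) ^ k \<le> real (card A) ^ k * (\<Sum>i\<in>A. x i ^ k)"
proof (cases "A = {}")
  case True
  then show ?thesis using assms by (simp add: zero_power)
next
  case False
  obtain j where j: "j \<in> A" "\<And>i. i \<in> A \<Longrightarrow> x i \<le> x j"
  proof -
    have "Max (x ` A) \<in> x ` A" using assms False by (intro Max_in) auto
    then obtain j where "j \<in> A" "x j = Max (x ` A)" by auto
    then show ?thesis using assms by (intro that[of j]) auto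
  qed
  have "(\<Sum>i\<in>A. x i) ^ k \<le> (real (card A) * x j) ^ k"
    using assms j by (intro power_mono sum_bounded_above sum_nonneg) auto
  also have "\<dots> = real (card A) ^ k * x j ^ k" by (rule power_mult_distrib)
  also have "\<dots> \<le> real (card A) ^ k * (\<Sum>i\<in>A. x i ^ k)"
    using assms j by (intro mult_left_mono member_le_sum) auto
  finally show ?thesis .
qed

lemma sum_mod_classes:
  fixes f :: "nat \<Rightarrow> 'a::comm_monoid_add"
  shows "(\<Sum>k<L * m. f k) = (\<Sum>s<m. \<Sum>j<L. f (j * m + s))"
proof -
  have "(\<Sum>k<L * m. f k) = (\<Sum>j<L. sum f {j * m..<j * m + m})"
    by (rule sum.nat_group[symmetric])
  also have "\<dots> = (\<Sum>j<L. \<Sum>s<m. f (j * m + s))"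
    by (simp add: sum.shift_bounds_nat_ivl[of f 0 "_ * m" m, simplified] add.commute atLeast0LessThan)
  also have "\<dots> = (\<Sum>s<m. \<Sum>j<L. f (j * m + s))" by (rule sum.swap)
  finally show ?thesis .
qed

text \<open>The first factor is the cost of splitting a sum into \<open>m\<close> residue classes,
  the second counts the classes, and \<open>2 * pi * fact m\<close> comes from the mean of a single
  class.\<close>

definition lacunary_const :: "nat \<Rightarrow> real" where
  "lacunary_const m = real m ^ (2 * m) * (real m * (2 * pi * fact m))"

text \<open>The exponents in one residue class modulo \<open>m\<close> grow by the factor \<open>2 ^ m > m\<close>.\<close>
lemma integral_lacunary_sum_le:
  fixes b :: "nat \<Rightarrow> real"
  assumes m: "m > 0"
  shows "integral {0..2 * pi} (\<lambda>t. norm (\<Sum>k<L. of_real (b k) * cis t ^ (2 ^ k)) ^ (2 * m))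
    \<le> lacunary_const m * (\<Sum>k<L. (b k)\<^sup>2) ^ m"
proof -
  \<comment> \<open>Padding with zeros up to \<open>L * m\<close> gives every residue class modulo
    \<open>m\<close> exactly \<open>L\<close> indices.\<close>
  define b' where "b' k = (if k < L then b k else 0)" for k
  define \<sigma> where "\<sigma> = (\<Sum>k<L. (b k)\<^sup>2)"
  have sub: "{..<L} \<subseteq> {..<L * m}" using m by (auto intro: less_le_trans)
  have ext: "(\<Sum>k<L. f (b k) k) = (\<Sum>s<m. \<Sum>j<L. f (b' (j * m + s)) (j * m + s))"
    if "\<And>k. f 0 k = 0" for f :: "real \<Rightarrow> nat \<Rightarrow> 'b::comm_monoid_add"
  proof -
    have "(\<Sum>k<L. f (b k) k) = (\<Sum>k<L * m. f (b' k) k)"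
      using sub that by (intro sum.mono_neutral_cong_left) (auto simp: b'_def)
    then show ?thesis by (simp only: sum_mod_classes)
  qed
  define P where "P s = (\<Sum>j<L. monom (complex_of_real (b' (j * m + s))) (2 ^ (j * m + s)))" for s
  have poly_P: "poly (P s) z = (\<Sum>j<L. of_real (b' (j * m + s)) * z ^ (2 ^ (j * m + s)))" for s z
    by (simp add: P_def poly_sum poly_monom)
  have P_mean: "integral {0..2 * pi} (\<lambda>t. norm (poly (P s) (cis t)) ^ (2 * m)) \<le> 2 * pi * (fact m * \<sigma> ^ m)"
    if "s < m" for s
  proof -
    have "m * 2 ^ (j * m + s) < (2 :: nat) ^ (Suc j * m + s)" for j
      by (simp add: power_add)
    then have "circle_mean_sq (P s ^ m) \<le> fact m * (\<Sum>j<L. (norm (complex_of_real (b' (j * m + s))))\<^sup>2) ^ m"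
      unfolding P_def by (intro circle_mean_sq_lacunary_power[where m = m]) auto
    also have "\<dots> \<le> fact m * \<sigma> ^ m"
    proof (intro mult_left_mono power_mono)
      have "(\<Sum>j<L. (norm (complex_of_real (b' (j * m + s))))\<^sup>2) = (\<Sum>j<L. (b' (j * m + s))\<^sup>2)" by simp
      also have "\<dots> \<le> (\<Sum>s<m. \<Sum>j<L. (b' (j * m + s))\<^sup>2)"
        using that by (intro member_le_sum) (auto intro: sum_nonneg)
      also have "\<dots> = \<sigma>" using ext[of "\<lambda>x k. x\<^sup>2"] by (simp add: \<sigma>_def)
      finally show "(\<Sum>j<L. (norm (complex_of_real (b' (j * m + s))))\<^sup>2) \<le> \<sigma>" .
    qed (auto intro: sum_nonneg)
    finally have "circle_mean_sq (P s ^ m) \<le> fact m * \<sigma> ^ m" .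
    \<comment> \<open>This is why even exponents are used: the \<open>2 * m\<close>-th power mean of
      \<open>P s\<close> is a mean square of the polynomial \<open>P s ^ m\<close>.\<close>
    moreover have "(norm (poly (P s ^ m) z))\<^sup>2 = norm (poly (P s) z) ^ (2 * m)" for z
      by (simp add: norm_power mult.commute flip: power_mult)
    ultimately show ?thesis
      by (simp add: circle_mean_sq_def pos_divide_le_eq mult.commute mult.left_commute)
  qed
  have "integral {0..2 * pi} (\<lambda>t. norm (\<Sum>k<L. of_real (b k) * cis t ^ (2 ^ k)) ^ (2 * m))
    \<le> integral {0..2 * pi} (\<lambda>t. real m ^ (2 * m) * (\<Sum>s<m. norm (poly (P s) (cis t)) ^ (2 * m)))"
  proof (rule integral_le)
    fix t
    have "(\<Sum>k<L. of_real (b k) * cis t ^ (2 ^ k)) = (\<Sum>s<m. poly (P s) (cis t))"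
      using ext[of "\<lambda>x k. of_real x * cis t ^ (2 ^ k)"] by (simp add: poly_P)
    also have "norm \<dots> \<le> (\<Sum>s<m. norm (poly (P s) (cis t)))" by (rule norm_sum)
    finally have "norm (\<Sum>k<L. of_real (b k) * cis t ^ (2 ^ k)) ^ (2 * m) \<le> (\<Sum>s<m. norm (poly (P s) (cis t))) ^ (2 * m)"
      by (intro power_mono) auto
    also have "\<dots> \<le> real m ^ (2 * m) * (\<Sum>s<m. norm (poly (P s) (cis t)) ^ (2 * m))"
      using power_sum_le_power_card_mult_sum[of "{..<m}" "\<lambda>s. norm (poly (P s) (cis t))" "2 * m"] m by simp
    finally show "norm (\<Sum>k<L. of_real (b k) * cis t ^ (2 ^ k)) ^ (2 * m) \<le> \<dots>" .
  qed (intro integrable_continuous_real continuous_intros)+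
  also have "\<dots> = real m ^ (2 * m) * (\<Sum>s<m. integral {0..2 * pi} (\<lambda>t. norm (poly (P s) (cis t)) ^ (2 * m)))"
    by (simp add: integral_sum integrable_norm_poly_cis)
  also have "\<dots> \<le> real m ^ (2 * m) * (\<Sum>s<m. 2 * pi * (fact m * \<sigma> ^ m))"
    using P_mean by (intro mult_left_mono sum_mono) auto
  also have "\<dots> = lacunary_const m * \<sigma> ^ m" by (simp add: lacunary_const_def mult_ac)
  finally show ?thesis unfolding \<sigma>_def .
qed

text \<open>Partial sums on the circle of radius \<open>r\<close> are lacunary polynomials on the
  unit circle with coefficients \<open>b k * r ^ (2 ^ k)\<close>, whose squares are no larger.
  Dominated convergence passes the bound to the series.\<close>

lemma integral_lacunary_le:
  fixes b :: "nat \<Rightarrow> real"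
  assumes b: "\<And>k. \<bar>b k\<bar> \<le> 1" and m: "m > 0" and r: "0 \<le> r" "r < 1"
    and tau: "\<And>L. (\<Sum>k<L. (b k)\<^sup>2) \<le> \<tau>"
  shows "integral {0..2 * pi} (\<lambda>t. norm (lacunary b (of_real r * cis t)) ^ (2 * m)) \<le> lacunary_const m * \<tau> ^ m"
proof -
  let ?S = "\<lambda>L t. \<Sum>k<L. of_real (b k) * (of_real r * cis t) ^ (2 ^ k) :: complex"
  have uni: "uniform_limit {0..2 * pi} ?S (\<lambda>t. lacunary b (of_real r * cis t)) sequentially"
    by (rule uniform_limit_compose'[OF uniform_limit_lacunary[OF b r]]) (use r in \<open>auto simp: norm_mult\<close>)
  have cont: "continuous_on {0..2 * pi} (\<lambda>t. lacunary b (of_real r * cis t))"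
    by (rule uniform_limit_theorem[OF _ uni]) (auto intro!: always_eventually continuous_intros)
  have bdd: "bounded ((\<lambda>t. lacunary b (of_real r * cis t)) ` {0..2 * pi})"
    by (intro compact_imp_bounded compact_continuous_image cont) auto
  have lim: "(\<lambda>L. integral {0..2 * pi} (\<lambda>t. norm (?S L t) ^ (2 * m))) \<longlonglongrightarrow>
    integral {0..2 * pi} (\<lambda>t. norm (lacunary b (of_real r * cis t)) ^ (2 * m))"
  proof (rule dominated_convergence(2))
    show "(\<lambda>t. norm (?S L t) ^ (2 * m)) integrable_on {0..2 * pi}" for L
      by (intro integrable_continuous_real continuous_intros)
    show "(\<lambda>t. (1 / (1 - r)) ^ (2 * m)) integrable_on {0..2 * pi}" by (rule integrable_const_ivl)
    fix t :: real
    have z: "norm (of_real r * cis t) \<le> r" "norm (of_real r * cis t) < 1" using r by (auto simp: norm_mult)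
    show "norm (norm (?S L t) ^ (2 * m)) \<le> (1 / (1 - r)) ^ (2 * m)" for L
    proof -
      have "norm (?S L t) \<le> (\<Sum>k<L. r ^ k)"
        using b z r by (intro sum_norm_le norm_lacunary_term_le) auto
      also have "\<dots> \<le> (\<Sum>k. r ^ k)"
        using r by (intro sum_le_suminf summable_geometric) auto
      also have "\<dots> = 1 / (1 - r)" using r by (intro suminf_geometric) auto
      finally show ?thesis by (simp add: power_mono)
    qed
    show "(\<lambda>L. norm (?S L t) ^ (2 * m)) \<longlonglongrightarrow> norm (lacunary b (of_real r * cis t)) ^ (2 * m)"
      using lacunary_sums[OF b z(2)] unfolding sums_def by (intro tendsto_intros)
  qed
  have "integral {0..2 * pi} (\<lambda>t. norm (?S L t) ^ (2 * m)) \<le> lacunary_const m * \<tau> ^ m" for L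
  proof -
    have "?S L t = (\<Sum>k<L. of_real (b k * r ^ (2 ^ k)) * cis t ^ (2 ^ k))" for t
      by (intro sum.cong refl) (simp add: power_mult_distrib)
    then have "integral {0..2 * pi} (\<lambda>t. norm (?S L t) ^ (2 * m)) \<le> lacunary_const m * (\<Sum>k<L. (b k * r ^ (2 ^ k))\<^sup>2) ^ m"
      using integral_lacunary_sum_le[OF m, of "\<lambda>k. b k * r ^ (2 ^ k)" L] by simp
    also have "\<dots> \<le> lacunary_const m * \<tau> ^ m"
    proof (intro mult_left_mono power_mono)
      have "(b k * r ^ (2 ^ k))\<^sup>2 \<le> (b k)\<^sup>2" for k
        using r by (simp add: power_mult_distrib mult_left_le power_le_one flip: power_mult)
      then have "(\<Sum>k<L. (b k * r ^ (2 ^ k))\<^sup>2) \<le> (\<Sum>k<L. (b k)\<^sup>2)" by (rule sum_mono)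
      also have "\<dots> \<le> \<tau>" by (rule tau)
      finally show "(\<Sum>k<L. (b k * r ^ (2 ^ k))\<^sup>2) \<le> \<tau>" .
    qed (auto simp: lacunary_const_def intro: sum_nonneg)
    finally show ?thesis .
  qed
  then show ?thesis by (intro LIMSEQ_le_const2[OF lim]) blast
qed

subsection \<open>Hardy norms and polynomial approximation\<close>

lemma powr_le_one_plus_power:
  fixes x p :: real
  assumes "0 \<le> x" "0 \<le> p" "p \<le> real k"
  shows "x powr p \<le> 1 + x ^ k"
proof (cases "x \<le> 1")
  case True
  then have "x powr p \<le> 1" using assms by (simp add: powr_le1)
  then show ?thesis using assms by (simp add: add_increasing2)
next
  case False
  then have "x powr p \<le> x powr real k" using assms by (intro powr_mono) auto
  also have "\<dots> = x ^ k" using False by (simp add: powr_realpow)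
  finally show ?thesis by simp
qed

lemma integral_add_const:
  fixes f :: "real \<Rightarrow> real"
  assumes "f integrable_on {0..2 * pi}"
  shows "integral {0..2 * pi} (\<lambda>t. f t + c) = integral {0..2 * pi} f + 2 * pi * c"
  by (subst integral_add[OF assms integrable_const_ivl]) simp

lemma continuous_on_circle:
  assumes "h holomorphic_on ball 0 1" "0 \<le> r" "r < 1"
  shows "continuous_on S (\<lambda>t. h (of_real r * cis t))"
  by (rule continuous_on_compose2[OF holomorphic_on_imp_continuous_on[OF assms(1)]])
    (use assms in \<open>auto intro!: continuous_intros simp: norm_mult\<close>)

lemma integral_mean_nonneg: "0 \<le> integral_mean p r h"
  by (simp add: integral_mean_def)

text \<open>Applying \<open>x powr p \<le> 1 + x ^ k\<close> to the modulus divided by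
  \<open>A\<close> bounds the mean of the \<open>p\<close>-th power by \<open>2 * A powr p\<close>.
  Taking the root costs \<open>2 powr (1 / p)\<close>, at most 2.\<close>

lemma integral_mean_le:
  assumes h: "h holomorphic_on ball 0 1" and r: "0 \<le> r" "r < 1"
    and p: "1 \<le> p" "p \<le> real k" and A: "0 < A"
    and le: "integral {0..2 * pi} (\<lambda>t. norm (h (of_real r * cis t)) ^ k) \<le> 2 * pi * A ^ k"
  shows "integral_mean p r h \<le> 2 * A"
proof -
  note cont = continuous_on_circle[OF h r, of "{0..2 * pi}"]
  let ?H = "\<lambda>t. norm (h (of_real r * cis t))"
  have int: "(\<lambda>t. ?H t powr p) integrable_on {0..2 * pi}"
    using p by (intro integrable_continuous_real continuous_on_powr' continuous_intros cont) auto
  have int': "(\<lambda>t. A powr p * (1 + ?H t ^ k / A ^ k)) integrable_on {0..2 * pi}"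
    by (intro integrable_continuous_real continuous_intros cont) (use A in auto)
  have "integral {0..2 * pi} (\<lambda>t. ?H t powr p) \<le> integral {0..2 * pi} (\<lambda>t. A powr p * (1 + ?H t ^ k / A ^ k))"
  proof (rule integral_le[OF int int'])
    fix t
    have "?H t powr p = A powr p * (?H t / A) powr p"
      using A by (simp flip: powr_mult)
    also have "\<dots> \<le> A powr p * (1 + (?H t / A) ^ k)"
      using A p by (intro mult_left_mono powr_le_one_plus_power) auto
    finally show "?H t powr p \<le> A powr p * (1 + ?H t ^ k / A ^ k)" by (simp add: power_divide)
  qed
  also have "\<dots> = A powr p * (2 * pi + integral {0..2 * pi} (\<lambda>t. ?H t ^ k) / A ^ k)"
  proof -
    have "(\<lambda>t. ?H t ^ k / A ^ k) integrable_on {0..2 * pi}"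
      by (intro integrable_continuous_real continuous_intros cont) (use A in auto)
    then have "integral {0..2 * pi} (\<lambda>t. ?H t ^ k / A ^ k + 1) = integral {0..2 * pi} (\<lambda>t. ?H t ^ k / A ^ k) + 2 * pi * 1"
      by (rule integral_add_const)
    then show ?thesis by (simp add: add.commute)
  qed
  also have "\<dots> \<le> A powr p * (2 * pi + 2 * pi)"
    using le A by (intro mult_left_mono add_left_mono) (auto simp: pos_divide_le_eq)
  finally have "1 / (2 * pi) * integral {0..2 * pi} (\<lambda>t. ?H t powr p) \<le> 2 * A powr p"
    by (simp add: field_simps)
  moreover have "0 \<le> integral {0..2 * pi} (\<lambda>t. ?H t powr p)"
    by (intro integral_nonneg int) auto
  ultimately have "integral_mean p r h \<le> (2 * A powr p) powr (1 / p)"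
    unfolding integral_mean_def using p by (intro powr_mono2) auto
  also have "\<dots> = 2 powr (1 / p) * A" using A p by (simp add: powr_mult powr_powr)
  also have "\<dots> \<le> 2 * A"
    using A p powr_mono[of "1 / p" 1 2] by (intro mult_right_mono) auto
  finally show ?thesis .
qed

lemma hardy_norm_nonneg:
  assumes "h \<in> hardy_space p"
  shows "0 \<le> hardy_norm p h"
  unfolding hardy_norm_def
  by (rule cSUP_upper2[where x = 0]) (use assms in \<open>auto simp: hardy_space_def integral_mean_nonneg\<close>)

lemma
  assumes h: "h holomorphic_on ball 0 1" and p: "1 \<le> p" "p \<le> real k" and A: "0 < A"
    and le: "\<And>r. 0 \<le> r \<Longrightarrow> r < 1 \<Longrightarrow> integral {0..2 * pi} (\<lambda>t. norm (h (of_real r * cis t)) ^ k) \<le> 2 * pi * A ^ k"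
  shows hardy_space_if_power_mean_le: "h \<in> hardy_space p"
    and hardy_norm_le_power_mean: "hardy_norm p h \<le> 2 * A"
proof -
  have *: "integral_mean p r h \<le> 2 * A" if "r \<in> {0..<1}" for r
    using integral_mean_le[OF h _ _ p A le] that by auto
  show "h \<in> hardy_space p"
    unfolding hardy_space_def using h * by (auto intro!: bdd_aboveI2[where M = "2 * A"])
  show "hardy_norm p h \<le> 2 * A"
    unfolding hardy_norm_def using * by (intro cSUP_least) auto
qed

text \<open>The infimum defining \<open>best_poly_approx\<close> runs over all polynomials of
  bounded degree, so every competitor, and not just a good one, needs a meaningful real Hardy norm.
  A polynomial is bounded on the closed disc and only changes the constant.\<close>

lemma hardy_space_diff_poly:
  assumes h: "h holomorphic_on ball 0 1" and p: "1 \<le> p" "p \<le> real k"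
    and le: "\<And>r. 0 \<le> r \<Longrightarrow> r < 1 \<Longrightarrow> integral {0..2 * pi} (\<lambda>t. norm (h (of_real r * cis t)) ^ k) \<le> C"
  shows "(\<lambda>z. h z - poly g z) \<in> hardy_space p"
proof -
  have k: "0 < k" using p by (cases k) auto
  have "bounded (poly g ` cball 0 1)"
    by (intro compact_imp_bounded compact_continuous_image continuous_intros) auto
  then obtain B where B: "0 < B" "\<And>z. norm z \<le> 1 \<Longrightarrow> norm (poly g z) \<le> B"
    by (force simp: bounded_pos)
  define D where "D = 2 ^ k * (C + 2 * pi * B ^ k)"
  \<comment> \<open>Taking at least 1 gives \<open>D \<le> A \<le> A ^ k\<close>, so no root of
    \<open>D\<close> has to be extracted.\<close>
  define A where "A = max 1 D"
  have hol: "(\<lambda>z. h z - poly g z) holomorphic_on ball 0 1"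
    by (intro holomorphic_intros h)
  have "integral {0..2 * pi} (\<lambda>t. norm (h (of_real r * cis t) - poly g (of_real r * cis t)) ^ k) \<le> 2 * pi * A ^ k"
    if r: "0 \<le> r" "r < 1" for r
  proof -
    note cont = continuous_on_circle[OF h r, of "{0..2 * pi}"]
    let ?H = "\<lambda>t. norm (h (of_real r * cis t))"
    have int: "(\<lambda>t. ?H t ^ k) integrable_on {0..2 * pi}"
      by (intro integrable_continuous_real continuous_intros cont)
    have "integral {0..2 * pi} (\<lambda>t. norm (h (of_real r * cis t) - poly g (of_real r * cis t)) ^ k)
      \<le> integral {0..2 * pi} (\<lambda>t. 2 ^ k * (?H t ^ k + B ^ k))"
    proof (rule integral_le)
      fix t
      have "norm (h (of_real r * cis t) - poly g (of_real r * cis t)) \<le> ?H t + norm (poly g (of_real r * cis t))"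
        by (rule norm_triangle_ineq4)
      also have "\<dots> \<le> ?H t + B" using r by (intro add_left_mono B(2)) (simp add: norm_mult)
      finally have "norm (h (of_real r * cis t) - poly g (of_real r * cis t)) ^ k \<le> (?H t + B) ^ k"
        by (intro power_mono) auto
      \<comment> \<open>The power of a two-term sum is treated as a sum over \<open>bool\<close>,
        whose cardinality yields the factor \<open>2 ^ k\<close>.\<close>
      also have "\<dots> \<le> 2 ^ k * (?H t ^ k + B ^ k)"
        using power_sum_le_power_card_mult_sum[of "UNIV :: bool set" "\<lambda>b. if b then ?H t else B" k] k B(1)
        by (simp add: UNIV_bool if_distrib[of "\<lambda>x. x ^ k"] add.commute)
      finally show "norm (h (of_real r * cis t) - poly g (of_real r * cis t)) ^ k \<le> 2 ^ k * (?H t ^ k + B ^ k)" .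
    qed (intro integrable_continuous_real continuous_intros cont)+
    also have "\<dots> = 2 ^ k * (integral {0..2 * pi} (\<lambda>t. ?H t ^ k) + 2 * pi * B ^ k)"
      by (simp only: integral_mult_right integral_add_const[OF int])
    also have "\<dots> \<le> D" unfolding D_def using le[OF r] by (intro mult_left_mono add_right_mono) auto
    also have "\<dots> \<le> A" by (simp add: A_def)
    also have "\<dots> \<le> A ^ k" using k by (intro self_le_power) (auto simp: A_def)
    also have "\<dots> \<le> 2 * pi * A ^ k"
      using pi_ge_two by (intro mult_le_cancel_right1[THEN iffD2]) (auto simp: A_def)
    finally show ?thesis .
  qed
  then show ?thesis
    by (intro hardy_space_if_power_mean_le[OF hol p, where A = A]) (auto simp: A_def)
qed

lemma best_poly_approx_nonneg:
  assumes "\<And>g. (\<lambda>z. f z - poly g z) \<in> hardy_space p"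
  shows "0 \<le> best_poly_approx n f p"
  unfolding best_poly_approx_def
proof (rule cINF_greatest)
  show "{g :: complex poly. degree g \<le> n} \<noteq> {}" by (auto intro: exI[of _ 0])
qed (use assms hardy_norm_nonneg in blast)

text \<open>Membership of all differences in the Hardy space makes their norms nonnegative, so the
  real infimum is over a set bounded below.\<close>

lemma best_poly_approx_le:
  assumes "\<And>g. (\<lambda>z. f z - poly g z) \<in> hardy_space p" "degree g \<le> n"
  shows "best_poly_approx n f p \<le> hardy_norm p (\<lambda>z. f z - poly g z)"
  unfolding best_poly_approx_def
  by (rule cINF_lower) (use assms hardy_norm_nonneg in \<open>auto intro!: bdd_belowI2[where m = 0]\<close>)

text \<open>The competitor is the Taylor polynomial of degree at most \<open>n\<close>. The
  remainder is again a lacunary series, so the mean estimates apply to it directly.\<close>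

lemma lacunary_diff_poly:
  assumes a: "\<And>k. \<bar>a k\<bar> \<le> 1"
  obtains g where "degree g \<le> n"
    "\<And>z. norm z < 1 \<Longrightarrow> lacunary a z - poly g z = lacunary (\<lambda>k. if 2 ^ k \<le> n then 0 else a k) z"
proof
  let ?g = "\<Sum>k\<in>{k. 2 ^ k \<le> n}. monom (complex_of_real (a k)) (2 ^ k)"
  have fin: "finite {k. 2 ^ k \<le> n}"
    by (rule finite_subset[of _ "{..n}"]) (auto intro: order_trans[OF less_imp_le[OF less_exp]])
  show "degree ?g \<le> n"
    by (intro degree_sum_le fin) (auto intro: order_trans[OF degree_monom_le])
  fix z :: complex assume z: "norm z < 1"
  let ?f = "\<lambda>k. of_real (a k) * z ^ (2 ^ k)"
  have "(\<lambda>k. ?f k - (if k \<in> {k. 2 ^ k \<le> n} then ?f k else 0)) sums (lacunary a z - (\<Sum>k\<in>{k. 2 ^ k \<le> n}. ?f k))"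
    by (intro sums_diff lacunary_sums a z sums_If_finite_set fin)
  moreover have "(\<lambda>k. ?f k - (if k \<in> {k. 2 ^ k \<le> n} then ?f k else 0)) =
      (\<lambda>k. of_real (if 2 ^ k \<le> n then 0 else a k) * z ^ (2 ^ k))"
    by auto
  moreover have "poly ?g z = (\<Sum>k\<in>{k. 2 ^ k \<le> n}. ?f k)"
    by (simp add: poly_sum poly_monom)
  ultimately show "lacunary a z - poly ?g z = lacunary (\<lambda>k. if 2 ^ k \<le> n then 0 else a k) z"
    unfolding lacunary_def by (simp add: sums_iff)
qed

text \<open>\<open>T n\<close> majorises the \<open>\<ell>\<^sup>2\<close> norm of the coefficients
  left after truncation at degree \<open>n\<close>. It does not involve \<open>p\<close>; only the
  constant \<open>c\<close> does.\<close>

proposition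
  assumes a: "\<And>k. \<bar>a k\<bar> \<le> 1" and T: "\<And>n. 0 < T n"
    and tail: "\<And>n L. (\<Sum>k<L. (if 2 ^ k \<le> n then 0 else a k)\<^sup>2) \<le> (T n)\<^sup>2"
    and p: "1 \<le> p"
  shows lacunary_in_hardy_space: "lacunary a \<in> hardy_space p"
    and best_poly_approx_lacunary_nonneg: "0 \<le> best_poly_approx n (lacunary a) p"
    and best_poly_approx_lacunary_bound: "\<exists>c. \<forall>n. best_poly_approx n (lacunary a) p \<le> c * T n"
proof -
  define m where "m = nat \<lceil>p\<rceil>"
  have m: "0 < m" "p \<le> real (2 * m)" using p by (auto simp: m_def) linarith+
  \<comment> \<open>Chosen so that \<open>lacunary_const m * T n ^ (2 * m)\<close> equals
    \<open>2 * pi * (c * T n) ^ (2 * m)\<close>.\<close>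
  define c where "c = root (2 * m) (lacunary_const m / (2 * pi))"
  have lc: "0 < lacunary_const m" using m by (simp add: lacunary_const_def)
  then have c: "0 < c" "c ^ (2 * m) = lacunary_const m / (2 * pi)"
    using m by (auto simp: c_def)
  let ?b = "\<lambda>n k. if 2 ^ k \<le> (n::nat) then 0 else a k"
  have *: "integral {0..2 * pi} (\<lambda>t. norm (lacunary (?b n) (of_real r * cis t)) ^ (2 * m)) \<le> 2 * pi * (c * T n) ^ (2 * m)"
    if "0 \<le> r" "r < 1" for n r
  proof -
    have "integral {0..2 * pi} (\<lambda>t. norm (lacunary (?b n) (of_real r * cis t)) ^ (2 * m)) \<le> lacunary_const m * ((T n)\<^sup>2) ^ m"
      using that m a by (intro integral_lacunary_le tail) auto
    also have "\<dots> = 2 * pi * (c * T n) ^ (2 * m)"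
      by (simp add: power_mult_distrib c power_mult[symmetric])
    finally show ?thesis .
  qed
  note hol = holomorphic_lacunary[OF a]
  \<comment> \<open>No power of 2 is at most 0, so truncation at \<open>n = 0\<close> removes
    nothing and the estimate covers the whole series.\<close>
  have b0: "?b 0 = a" by (simp add: fun_eq_iff)
  have diff: "(\<lambda>z. lacunary a z - poly g z) \<in> hardy_space p" for g
    by (rule hardy_space_diff_poly[OF hol p m(2)]) (use *[where n = 0] b0 in auto)
  show "lacunary a \<in> hardy_space p" using diff[of 0] by simp
  show "0 \<le> best_poly_approx n (lacunary a) p" by (rule best_poly_approx_nonneg[OF diff])
  have "best_poly_approx n (lacunary a) p \<le> 2 * c * T n" for n
  proof -
    obtain g where g: "degree g \<le> n" "\<And>z. norm z < 1 \<Longrightarrow> lacunary a z - poly g z = lacunary (?b n) z"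
      by (rule lacunary_diff_poly[OF a, of n]) (rule that)
    have "best_poly_approx n (lacunary a) p \<le> hardy_norm p (\<lambda>z. lacunary a z - poly g z)"
      by (rule best_poly_approx_le[OF diff g(1)])
    also have "\<dots> \<le> 2 * (c * T n)"
    proof (rule hardy_norm_le_power_mean[OF _ p m(2)])
      show "(\<lambda>z. lacunary a z - poly g z) holomorphic_on ball 0 1"
        by (intro holomorphic_intros hol)
      show "0 < c * T n" using c T by simp
      fix r :: real assume r: "0 \<le> r" "r < 1"
      then show "integral {0..2 * pi} (\<lambda>t. norm (lacunary a (of_real r * cis t) - poly g (of_real r * cis t)) ^ (2 * m))
          \<le> 2 * pi * (c * T n) ^ (2 * m)"
        using *[OF r, of n] by (simp add: g(2) norm_mult)
    qed
    finally show ?thesis by simp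
  qed
  then show "\<exists>c. \<forall>n. best_poly_approx n (lacunary a) p \<le> c * T n" by blast
qed

subsection \<open>Choice of the coefficients\<close>

text \<open>A discrete form of the fact that \<open>2 * sqrt (ln x)\<close> is an antiderivative of
  \<open>1 / (x * sqrt (ln x))\<close>. The terms for \<open>n = 0\<close> and \<open>n = 1\<close>
  are 0 by division by zero.\<close>

lemma sum_inverse_mult_sqrt_ln_le:
  assumes "M \<ge> 1"
  shows "(\<Sum>n<Suc M. 1 / (real n * sqrt (ln (real n)))) \<le> 2 * sqrt (ln (real M))"
  using assms
proof (induction M rule: nat_induct_at_least)
  case base
  then show ?case by simp
next
  case (Suc M)
  define x where "x = sqrt (ln (real (Suc M)))"
  define y where "y = sqrt (ln (real M))"
  have x: "0 < x" and y: "0 \<le> y" "y \<le> x" using Suc.hyps by (auto simp: x_def y_def)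
  have "ln (real M / real (Suc M)) \<le> real M / real (Suc M) - 1"
    using Suc.hyps by (intro ln_le_minus_one) simp
  also have "\<dots> = - (1 / real (Suc M))" by (simp add: field_simps)
  also have "ln (real M / real (Suc M)) = y\<^sup>2 - x\<^sup>2"
    using Suc.hyps by (simp add: x_def y_def ln_div)
  finally have "1 / real (Suc M) \<le> (x - y) * (x + y)"
    by (simp add: power2_eq_square algebra_simps)
  also have "\<dots> \<le> (x - y) * (2 * x)" using y by (intro mult_left_mono) auto
  also have "\<dots> = (2 * x - 2 * y) * x" by (simp add: algebra_simps)
  finally have "1 / (real (Suc M) * x) \<le> 2 * x - 2 * y"
    using x by (simp only: pos_divide_le_eq flip: divide_divide_eq_left)
  moreover have "(\<Sum>n<Suc M. 1 / (real n * sqrt (ln (real n)))) \<le> 2 * y"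
    unfolding y_def by (rule Suc.IH)
  ultimately show ?case
    unfolding sum.lessThan_Suc[of _ "Suc M"] x_def by linarith
qed

text \<open>Up to \<open>2 ^ (2 ^ Suc e)\<close> the weights without \<open>\<phi>\<close> sum to at
  most a constant times \<open>sqrt (2 ^ e)\<close>. Since \<open>\<phi>\<close> tends to 0, that
  constant can be made small at the price of finitely many initial terms, which growing
  \<open>e\<close> absorbs.\<close>

lemma sum_weight_le:
  fixes \<phi> :: "real \<Rightarrow> real"
  assumes pos: "\<And>x. x \<ge> 1 \<Longrightarrow> \<phi> x > 0" and lim: "(\<phi> \<longlongrightarrow> 0) at_top" and "\<delta> > 0"
  shows "\<forall>\<^sub>F e in sequentially.
    (\<Sum>n<2 ^ (2 ^ Suc e). \<phi> (real n) / (real n * sqrt (ln (real n)))) \<le> \<delta> * sqrt (2 ^ e)"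
proof -
  let ?v = "\<lambda>n. 1 / (real n * sqrt (ln (real n)))"
  let ?w = "\<lambda>n. \<phi> (real n) / (real n * sqrt (ln (real n)))"
  have v: "0 \<le> ?v n" for n by (cases "n = 0") auto
  \<comment> \<open>The weight sum is at most \<open>4 * sqrt (2 ^ e)\<close>, so
    \<open>\<delta> / 8\<close> uses up half of \<open>\<delta>\<close>. The other half absorbs
    \<open>C\<close> once \<open>2 * C / \<delta> \<le> sqrt (2 ^ e)\<close>.\<close>
  have "\<forall>\<^sub>F x in at_top. \<phi> x < \<delta> / 8"
    using lim \<open>\<delta> > 0\<close> by (intro order_tendstoD) auto
  then obtain N where N: "\<And>n. n \<ge> N \<Longrightarrow> \<phi> (real n) < \<delta> / 8"
    using filterlim_real_sequentially unfolding filterlim_iff eventually_sequentially by blast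
  define C where "C = (\<Sum>n<N. \<bar>?w n\<bar>)"
  obtain e\<^sub>0 where e\<^sub>0: "2 * C / \<delta> < sqrt 2 ^ e\<^sub>0"
    using real_arch_pow[of "sqrt 2"] by auto
  have "2 * C / \<delta> \<le> sqrt (2 ^ e)" if "e \<ge> e\<^sub>0" for e
  proof -
    have "sqrt 2 ^ e\<^sub>0 \<le> sqrt 2 ^ e" using that by (intro power_increasing) auto
    with e\<^sub>0 show ?thesis unfolding real_sqrt_power by linarith
  qed
  then have "\<forall>\<^sub>F e in sequentially. 2 * C / \<delta> \<le> sqrt (2 ^ e)"
    unfolding eventually_sequentially by blast
  then show ?thesis
  proof eventually_elim
    case (elim e)
    let ?M = "2 ^ (2 ^ Suc e) :: nat"
    have w_le: "?w n \<le> (if n < N then \<bar>?w n\<bar> else 0) + \<delta> / 8 * ?v n" for n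
    proof (cases "n < N")
      case True
      have "0 \<le> \<delta> / 8 * ?v n" using v[of n] \<open>\<delta> > 0\<close> by (intro mult_nonneg_nonneg) auto
      then show ?thesis using True abs_ge_self[of "?w n"] by simp
    next
      case False
      have "?w n = \<phi> (real n) * ?v n" by simp
      also have "\<dots> \<le> \<delta> / 8 * ?v n"
        using False N[of n] v[of n] by (intro mult_right_mono) auto
      finally show ?thesis using False by simp
    qed
    have "(\<Sum>n<?M. ?w n) \<le> (\<Sum>n<?M. (if n < N then \<bar>?w n\<bar> else 0) + \<delta> / 8 * ?v n)"
      by (intro sum_mono w_le)
    also have "\<dots> = (\<Sum>n<?M. if n < N then \<bar>?w n\<bar> else 0) + \<delta> / 8 * (\<Sum>n<?M. ?v n)"
      by (simp only: sum.distrib sum_distrib_left)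
    also have "(\<Sum>n<?M. if n < N then \<bar>?w n\<bar> else 0) = (\<Sum>n\<in>{..<?M} \<inter> {n. n < N}. \<bar>?w n\<bar>)"
      by (simp only: sum.inter_restrict[OF finite_lessThan] mem_Collect_eq)
    also have "\<dots> \<le> C" unfolding C_def by (intro sum_mono2) auto
    also have "(\<Sum>n<?M. ?v n) \<le> (\<Sum>n<Suc ?M. ?v n)" using v[of ?M] by simp
    also have "\<dots> \<le> 2 * sqrt (ln (real ?M))" by (rule sum_inverse_mult_sqrt_ln_le) simp
    also have "ln (real ?M) = 2 * 2 ^ e * ln 2" by (simp add: ln_realpow)
    also have "2 * 2 ^ e * ln 2 \<le> 2 * 2 ^ e * (2::real)"
      using ln_2_less_1 by (intro mult_left_mono) auto
    also have "sqrt (2 * 2 ^ e * 2) = 2 * sqrt (2 ^ e)"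
      by (simp add: real_sqrt_mult)
    finally have "(\<Sum>n<?M. ?w n) \<le> C + \<delta> / 8 * (2 * (2 * sqrt (2 ^ e)))"
      using \<open>\<delta> > 0\<close> by simp
    moreover have "2 * C \<le> \<delta> * sqrt (2 ^ e)"
      using elim \<open>\<delta> > 0\<close> by (simp add: pos_divide_le_eq mult.commute)
    ultimately show ?case by linarith
  qed
qed

text \<open>Telescoping with \<open>1 / x\<^sup>2 \<le> 2 / x - 2 / (x + 1)\<close> for
  \<open>x \<ge> 1\<close>; the induction keeps the subtracted term.\<close>

lemma sum_inverse_square_tail_le:
  assumes "0 < K"
  shows "(\<Sum>k<L. if K \<le> k then 1 / (real k)\<^sup>2 else 0) \<le> 2 / real K"
proof -
  have *: "(\<Sum>k<K + d. if K \<le> k then 1 / (real k)\<^sup>2 else 0) \<le> 2 / real K - 2 / real (K + d)" for d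
  proof (induction d)
    case 0
    show ?case by simp
  next
    case (Suc d)
    define x where "x = real (K + d)"
    have x: "1 \<le> x" using assms by (simp add: x_def)
    have "1 / x\<^sup>2 \<le> 2 / x - 2 / (x + 1)"
    proof -
      have "1 / x\<^sup>2 = 2 / (x * (x + x))" using x by (simp add: power2_eq_square)
      also have "\<dots> \<le> 2 / (x * (x + 1))"
        using x by (intro divide_left_mono mult_left_mono) auto
      also have "\<dots> = 2 / x - 2 / (x + 1)" using x by (simp add: field_simps)
      finally show ?thesis .
    qed
    then show ?case using Suc.IH by (simp add: x_def add_ac)
  qed
  have "(\<Sum>k<L. if K \<le> k then 1 / (real k)\<^sup>2 else 0) \<le> (\<Sum>k<K + L. if K \<le> k then 1 / (real k)\<^sup>2 else 0)"
    by (intro sum_mono2) auto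
  also have "\<dots> \<le> 2 / real K - 2 / real (K + L)" by (rule *)
  also have "\<dots> \<le> 2 / real K" by simp
  finally show ?thesis .
qed

text \<open>The coefficients are \<open>1 / k\<close> on a sparse union of dyadic blocks \<open>{2 ^ e..<2 ^ Suc e}\<close>. Each
  block adds at least \<open>1 / 2\<close> to the sum of the coefficients, but only about \<open>1 / 2 ^ e\<close> to the sum
  of their squares.\<close>
lemma sparse_coefficients:
  fixes w :: "nat \<Rightarrow> real"
  assumes w: "\<And>n. 0 \<le> w n"
    and small: "\<And>\<delta>. \<delta> > 0 \<Longrightarrow> \<forall>\<^sub>F e in sequentially. (\<Sum>n<2 ^ (2 ^ Suc e). w n) \<le> \<delta> * sqrt (2 ^ e)"
  obtains a T where "\<And>k. 0 \<le> a k" "\<And>k. a k \<le> 1" "\<not> summable a" "\<And>n. 0 < T n"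
    "\<And>n L. (\<Sum>k<L. (if 2 ^ k \<le> n then 0 else a k)\<^sup>2) \<le> (T n :: real)\<^sup>2" "summable (\<lambda>n. w n * T n)"
proof -
  let ?W = "\<lambda>e. \<Sum>n<2 ^ (2 ^ Suc e). w n"
  have "\<forall>i. \<exists>N. \<forall>e\<ge>N. ?W e \<le> (1 / 2) ^ i * sqrt (2 ^ e)"
    using small unfolding eventually_sequentially by simp
  then obtain g where g: "\<And>i e. e \<ge> g i \<Longrightarrow> ?W e \<le> (1 / 2) ^ i * sqrt (2 ^ e)" by metis
  \<comment> \<open>The sum makes \<open>E\<close> monotone and at least \<open>g i\<close>; the
    summand \<open>i\<close> makes it unbounded.\<close>
  define E where "E i = i + (\<Sum>j\<le>i. g j)" for i
  have E_mono: "E i \<le> E j" if "i \<le> j" for i j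
    using that unfolding E_def by (intro add_mono sum_mono2) auto
  have E_ge: "i \<le> E i" for i by (simp add: E_def)
  have "g i \<le> E i" for i unfolding E_def by (intro trans_le_add2 member_le_sum) auto
  then have W: "?W (E i) \<le> (1 / 2) ^ i * sqrt (2 ^ E i)" for i by (rule g)
  define S where "S = (\<Union>i. {2 ^ E i..<2 ^ Suc (E i)} :: nat set)"
  define a where "a k = (if k \<in> S then 1 / real k else 0)" for k
  \<comment> \<open>Any block containing some \<open>k\<close> with \<open>n < 2 ^ k\<close> has
    index at least \<open>I n\<close>. The coefficients surviving truncation at \<open>n\<close>
    thus start at \<open>2 ^ E (I n)\<close> or later, and \<open>T n\<close> is the resulting bound
    for their square sum.\<close>
  define I where "I n = (LEAST i. n < 2 ^ (2 ^ Suc (E i)))" for n :: nat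
  define T where "T n = sqrt (2 / 2 ^ E (I n))" for n
  have reach: "n < 2 ^ (2 ^ Suc (E n))" for n :: nat
  proof -
    have "n \<le> 2 ^ Suc (E n)"
      using E_ge[of n] less_exp[of "Suc (E n)"] by linarith
    then show ?thesis by (rule le_less_trans) (rule less_exp)
  qed
  have I: "n < 2 ^ (2 ^ Suc (E (I n)))" for n unfolding I_def by (rule LeastI, rule reach)
  have I_le: "I n \<le> i" if "n < 2 ^ (2 ^ Suc (E i))" for n i unfolding I_def using that by (rule Least_le)
  show ?thesis
  proof (rule that[of a T])
    show "0 \<le> a k" "a k \<le> 1" for k by (auto simp: a_def divide_le_eq)
    show "0 < T n" for n by (simp add: T_def)
    show "\<not> summable a"
    proof
      assume "summable a"
      then obtain N where N: "\<And>m n. m \<ge> N \<Longrightarrow> norm (sum a {m..<n}) < 1 / 2"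
        unfolding summable_Cauchy by (meson half_gt_zero zero_less_one)
      \<comment> \<open>The block with index \<open>N\<close> starts beyond \<open>N\<close>, and
        its \<open>?m\<close> coefficients are each at least \<open>1 / (2 * ?m)\<close>,
        contradicting the Cauchy criterion.\<close>
      let ?m = "2 ^ E N :: nat"
      have "N \<le> ?m" using E_ge[of N] less_exp[of "E N"] by linarith
      then have "norm (sum a {?m..<2 * ?m}) < 1 / 2" by (rule N)
      moreover have "real (card {?m..<2 * ?m}) * (1 / real (2 * ?m)) \<le> sum a {?m..<2 * ?m}"
      proof (rule sum_bounded_below)
        fix k assume k: "k \<in> {?m..<2 * ?m}"
        then have "k \<in> S" unfolding S_def by auto
        moreover have "0 < k" using k by (auto intro: less_le_trans[of 0 "2 ^ E N"])
        moreover have "real k \<le> real (2 * ?m)"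
          using k unfolding of_nat_le_iff by simp
        ultimately show "1 / real (2 * ?m) \<le> a k"
          unfolding a_def by (simp only: if_True) (intro divide_left_mono; simp)
      qed
      ultimately show False by simp
    qed
    show "(\<Sum>k<L. (if 2 ^ k \<le> n then 0 else a k)\<^sup>2) \<le> (T n)\<^sup>2" for n L
    proof -
      have "(if 2 ^ k \<le> n then 0 else a k)\<^sup>2 \<le> (if 2 ^ E (I n) \<le> k then 1 / (real k)\<^sup>2 else 0)" for k
      proof (cases "2 ^ k \<le> n \<or> k \<notin> S")
        case True
        then show ?thesis by (auto simp: a_def)
      next
        case False
        then obtain i where i: "2 ^ E i \<le> k" "k < 2 ^ Suc (E i)" by (auto simp: S_def)
        have "n < 2 ^ k" using False by simp
        also have "(2::nat) ^ k \<le> 2 ^ (2 ^ Suc (E i))" using i by (intro power_increasing) auto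
        finally have "E (I n) \<le> E i" by (intro E_mono I_le)
        then have "(2::nat) ^ E (I n) \<le> 2 ^ E i" by (intro power_increasing) auto
        then have "2 ^ E (I n) \<le> k" using i by linarith
        then show ?thesis using False by (simp add: a_def power_divide)
      qed
      then have "(\<Sum>k<L. (if 2 ^ k \<le> n then 0 else a k)\<^sup>2) \<le> (\<Sum>k<L. if 2 ^ E (I n) \<le> k then 1 / (real k)\<^sup>2 else 0)"
        by (rule sum_mono)
      also have "\<dots> \<le> 2 / real (2 ^ E (I n))" by (rule sum_inverse_square_tail_le) simp
      finally show ?thesis by (simp add: T_def)
    qed
    show "summable (\<lambda>n. w n * T n)"
    proof (rule summableI_nonneg_bounded)
      show "0 \<le> w n * T n" for n using w by (simp add: T_def)
      fix M
      \<comment> \<open>The unknown index \<open>I n\<close>, at most \<open>n\<close>, is replaced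
        by a sum over all \<open>i\<close> with \<open>n < 2 ^ (2 ^ Suc (E i))\<close>. After
        swapping the sums, the choice of \<open>E i\<close> makes the \<open>i\<close>-th
        contribution geometrically small.\<close>
      have "(\<Sum>n<M. w n * T n) \<le> (\<Sum>n<M. \<Sum>i\<le>M. if n < 2 ^ (2 ^ Suc (E i)) then w n * sqrt (2 / 2 ^ E i) else 0)"
      proof (intro sum_mono)
        fix n assume n: "n \<in> {..<M}"
        let ?f = "\<lambda>i. if n < 2 ^ (2 ^ Suc (E i)) then w n * sqrt (2 / 2 ^ E i) else 0"
        have "I n \<in> {..M}" using I_le[OF reach, of n] n by simp
        then have "?f (I n) \<le> (\<Sum>i\<le>M. ?f i)" using w by (intro member_le_sum) auto
        then show "w n * T n \<le> (\<Sum>i\<le>M. ?f i)" using I[of n] by (simp add: T_def)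
      qed
      also have "\<dots> = (\<Sum>i\<le>M. \<Sum>n<M. if n < 2 ^ (2 ^ Suc (E i)) then w n * sqrt (2 / 2 ^ E i) else 0)"
        by (rule sum.swap)
      also have "\<dots> \<le> (\<Sum>i\<le>M. sqrt 2 * (1 / 2) ^ i)"
      proof (intro sum_mono)
        fix i
        have "(\<Sum>n<M. if n < 2 ^ (2 ^ Suc (E i)) then w n * sqrt (2 / 2 ^ E i) else 0) =
            (\<Sum>n\<in>{..<M} \<inter> {..<2 ^ (2 ^ Suc (E i))}. w n * sqrt (2 / 2 ^ E i))"
          by (subst sum.inter_restrict) auto
        also have "\<dots> \<le> (\<Sum>n<2 ^ (2 ^ Suc (E i)). w n * sqrt (2 / 2 ^ E i))"
          using w by (intro sum_mono2) auto
        also have "\<dots> = ?W (E i) * sqrt (2 / 2 ^ E i)" by (simp only: sum_distrib_right)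
        also have "\<dots> \<le> (1 / 2) ^ i * sqrt (2 ^ E i) * sqrt (2 / 2 ^ E i)"
          by (intro mult_right_mono W) auto
        also have "\<dots> = sqrt 2 * (1 / 2) ^ i" by (simp add: real_sqrt_divide)
        finally show "(\<Sum>n<M. if n < 2 ^ (2 ^ Suc (E i)) then w n * sqrt (2 / 2 ^ E i) else 0) \<le> sqrt 2 * (1 / 2) ^ i" .
      qed
      also have "\<dots> \<le> (\<Sum>i. sqrt 2 * (1 / 2) ^ i)"
        by (intro sum_le_suminf summable_mult summable_geometric) auto
      finally show "(\<Sum>n<M. w n * T n) \<le> (\<Sum>i. sqrt 2 * (1 / 2) ^ i)" .
    qed
  qed
qed

section \<open>Combination of the estimates into one function for all exponents\<close>

theorem proposition1p7:
  fixes \<phi> :: "real \<Rightarrow> real"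
  assumes "\<And>x. x \<ge> 1 \<Longrightarrow> \<phi> x > 0"
    and "(\<phi> \<longlongrightarrow> 0) at_top"
  shows "\<exists>f :: complex \<Rightarrow> complex. f holomorphic_on ball 0 1 \<and>
           (\<forall>p::real. 1 \<le> p \<longrightarrow>
              f \<in> hardy_space p \<and>
              (\<lambda>n::nat. best_poly_approx n f p / (real n * sqrt (ln (real n))) * \<phi> (real n))
                summable_on {2..}) \<and>
           deriv f \<notin> bergman_space1"
proof -
  define w where "w n = \<phi> (real n) / (real n * sqrt (ln (real n)))" for n
  have w: "0 \<le> w n" for n
    \<comment> \<open>At \<open>n = 0\<close>, where the sign of \<open>\<phi>\<close> is unknown,
      division by zero makes the weight 0.\<close>
    using assms(1)[of "real n"] by (cases "n = 0") (auto simp: w_def less_imp_le)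
  have small: "\<forall>\<^sub>F e in sequentially. (\<Sum>n<2 ^ (2 ^ Suc e). w n) \<le> \<delta> * sqrt (2 ^ e)" if "\<delta> > 0" for \<delta>
    unfolding w_def using sum_weight_le[OF assms that] .
  \<comment> \<open>The coefficients and \<open>T\<close> are fixed before \<open>p\<close>, so the
    same function works for every exponent.\<close>
  obtain a T where a: "\<And>k. 0 \<le> a k" "\<And>k. a k \<le> 1" "\<not> summable a" and T: "\<And>n. 0 < T n"
    and tail: "\<And>n L. (\<Sum>k<L. (if 2 ^ k \<le> n then 0 else a k)\<^sup>2) \<le> (T n)\<^sup>2"
    and sum: "summable (\<lambda>n. w n * T n)"
    by (rule sparse_coefficients[OF w small], assumption) (rule that)
  have a': "\<bar>a k\<bar> \<le> 1" for k using a(1)[of k] a(2)[of k] by simp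
  show ?thesis
  proof (intro exI[of _ "lacunary a"] conjI allI impI)
    show "lacunary a holomorphic_on ball 0 1" by (rule holomorphic_lacunary[OF a'])
    show "deriv (lacunary a) \<notin> bergman_space1" by (rule deriv_lacunary_notin_bergman[OF a])
    fix p :: real assume p: "1 \<le> p"
    show "lacunary a \<in> hardy_space p" by (rule lacunary_in_hardy_space[OF a' T tail p])
    obtain c where c: "\<And>n. best_poly_approx n (lacunary a) p \<le> c * T n"
      using best_poly_approx_lacunary_bound[OF a' T tail p] by blast
    note nonneg = best_poly_approx_lacunary_nonneg[OF a' T tail p]
    \<comment> \<open>Absolute convergence over all \<open>n\<close> is shown first, since it yields
      unordered summability, which then restricts to \<open>{2..}\<close>.\<close>
    have "summable (\<lambda>n. norm (best_poly_approx n (lacunary a) p * w n))"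
    proof (rule summable_comparison_test')
      show "summable (\<lambda>n. c * (w n * T n))" using sum by (rule summable_mult)
      show "norm (norm (best_poly_approx n (lacunary a) p * w n)) \<le> c * (w n * T n)" for n
        using mult_right_mono[OF c[of n] w[of n]] nonneg[of n] w[of n] by (simp add: abs_mult mult_ac)
    qed
    then have "(\<lambda>n. best_poly_approx n (lacunary a) p * w n) summable_on UNIV"
      by (rule norm_summable_imp_summable_on)
    then have "(\<lambda>n. best_poly_approx n (lacunary a) p * w n) summable_on {2..}"
      by (rule summable_on_subset_banach) simp
    then show "(\<lambda>n. best_poly_approx n (lacunary a) p / (real n * sqrt (ln (real n))) * \<phi> (real n)) summable_on {2..}"
      by (simp add: w_def)
  qed
qed

end
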